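(* There exists a reflexive Banach space $Y$ which is not asymptotically symmetric and yet for some $C<\infty$ the following holds: for all $m\in\mathbb{N}$, all permutations $\sigma$ of $\{1,\ldots,m\}$, all normalized weakly null sequences $(x_n^i)_{n=1}^\infty$ in $Y$, $1\le i\le m$, and all ultrafilters $\mathcal{U}_1,\ldots,\mathcal{U}_m$ on $\mathbb{N}$, $$\lim_{n_1,\mathcal{U}_1}\cdots\lim_{n_m,\mathcal{U}_m}\Big\|\sum_{i=1}^m x_{n_i}^i\Big\|\le C\lim_{n_{\sigma(1)},\mathcal{U}_{\sigma(1)}}\cdots\lim_{n_{\sigma(m)},\mathcal{U}_{\sigma(m)}}\Big\|\sum_{i=1}^m x_{n_i}^i\Big\|.$$
   Context: A Banach space $X$ is asymptotically symmetric if there is $C<\infty$ such that for all $m\in\mathbb{N}$, all permutations $\sigma$ of $\{1,\ldots,m\}$, all bounded sequences $(x_n^i)_{n=1}^\infty\subseteq X$, $1\le i\le m$, and all ultrafilters $\mathcal{U}_1,\ldots,\mathcal{U}_m$ on $\mathbb{N}$, $$\lim_{n_1,\mathcal{U}_1}\cdots\lim_{n_m,\mathcal{U}_m}\Big\|\sum_{i=1}^m x_{n_i}^i\Big\|\le C\lim_{n_{\sigma(1)},\mathcal{U}_{\sigma(1)}}\cdots\lim_{n_{\sigma(m)},\mathcal{U}_{\sigma(m)}}\Big\|\sum_{i=1}^m x_{n_i}^i\Big\|.$$ A sequence is normalized if all its terms have norm $1$. *)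

theory Defs
  imports Complex_Main "HOL-Library.Function_Algebras" "HOL-Combinatorics.Permutations"
begin

instantiation "fun" :: (type, real_vector) real_vector
begin

definition scaleR_fun :: "real \<Rightarrow> ('a \<Rightarrow> 'b) \<Rightarrow> 'a \<Rightarrow> 'b"
  where "scaleR_fun c f = (\<lambda>x. c *\<^sub>R f x)"

instance
  by standard (auto simp: scaleR_fun_def fun_eq_iff scaleR_add_right scaleR_add_left)

end

lemma scaleR_fun_apply [simp]: "(c *\<^sub>R f) x = c *\<^sub>R f x"
  by (simp add: scaleR_fun_def)


text \<open>
  Real normed spaces are represented by a carrier \<open>V\<close>, a linear subspace of an ambient real
  vector space that itself carries no relevant topology, together with a norm \<open>N\<close>, of which only
  the values on \<open>V\<close> matter. This makes it possible to quantify existentially over spaces.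
  A space whose algebraic dimension is at most that of the space of all real sequences (for
  example, any separable one) has, up to linear isometry, a carrier inside \<open>nat \<Rightarrow> real\<close>.
\<close>

locale normed_space_on =
  fixes V :: "'a::real_vector set" and N :: "'a \<Rightarrow> real"
  assumes subspace: "subspace V"
    and norm_nonneg: "x \<in> V \<Longrightarrow> 0 \<le> N x"
    and norm_eq_zero_iff: "x \<in> V \<Longrightarrow> N x = 0 \<longleftrightarrow> x = 0"
    and norm_scaleR: "x \<in> V \<Longrightarrow> N (c *\<^sub>R x) = \<bar>c\<bar> * N x"
    and norm_triangle: "x \<in> V \<Longrightarrow> y \<in> V \<Longrightarrow> N (x + y) \<le> N x + N y"

locale banach_space_on = normed_space_on +
  assumes complete:
    "\<lbrakk>\<And>n::nat. X n \<in> V; \<And>e. 0 < e \<Longrightarrow> \<exists>M. \<forall>m\<ge>M. \<forall>n\<ge>M. N (X m - X n) < e\<rbrakk>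
      \<Longrightarrow> \<exists>L\<in>V. (\<lambda>n. N (X n - L)) \<longlonglongrightarrow> 0"

text \<open>
  Continuous linear functionals on \<open>V\<close>, extended by \<open>0\<close> outside \<open>V\<close> so that distinct elements
  are distinct functionals; the dual is then again a subspace of a real vector space, and the
  construction can be iterated.
\<close>

definition dual_space :: "'a::real_vector set \<Rightarrow> ('a \<Rightarrow> real) \<Rightarrow> ('a \<Rightarrow> real) set" where
  "dual_space V N = {f.
     (\<forall>x\<in>V. \<forall>y\<in>V. f (x + y) = f x + f y) \<and>
     (\<forall>c. \<forall>x\<in>V. f (c *\<^sub>R x) = c * f x) \<and>
     (\<exists>B. \<forall>x\<in>V. \<bar>f x\<bar> \<le> B * N x) \<and>
     (\<forall>x. x \<notin> V \<longrightarrow> f x = 0)}"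

definition dual_norm :: "'a::real_vector set \<Rightarrow> ('a \<Rightarrow> real) \<Rightarrow> ('a \<Rightarrow> real) \<Rightarrow> real" where
  "dual_norm V N f = Sup {\<bar>f x\<bar> |x. x \<in> V \<and> N x \<le> 1}"

lemma dual_space_bounded: "f \<in> dual_space V N \<Longrightarrow> \<exists>B. \<forall>x\<in>V. \<bar>f x\<bar> \<le> B * N x"
  unfolding dual_space_def by blast

lemma (in normed_space_on) dual_apply_le:
  assumes f: "f \<in> dual_space V N" and x: "x \<in> V" "N x \<le> 1"
  shows "\<bar>f x\<bar> \<le> dual_norm V N f"
proof -
  obtain B where B: "\<And>x. x \<in> V \<Longrightarrow> \<bar>f x\<bar> \<le> B * N x"
    using dual_space_bounded[OF f] by blast
  have "\<bar>f y\<bar> \<le> \<bar>B\<bar>" if y: "y \<in> V" "N y \<le> 1" for y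
  proof -
    have "\<bar>f y\<bar> \<le> \<bar>B\<bar> * N y"
      using B[OF y(1)] norm_nonneg[OF y(1)] by (meson abs_ge_self mult_right_mono order_trans)
    also have "\<dots> \<le> \<bar>B\<bar> * 1"
      using y(2) by (intro mult_left_mono) auto
    finally show ?thesis by simp
  qed
  then have "bdd_above {\<bar>f x\<bar> |x. x \<in> V \<and> N x \<le> 1}"
    by (intro bdd_aboveI[of _ "\<bar>B\<bar>"]) auto
  then show ?thesis
    unfolding dual_norm_def using x by (intro cSup_upper) auto
qed

lemma (in normed_space_on) dual_norm_leI:
  assumes "\<And>x. x \<in> V \<Longrightarrow> N x \<le> 1 \<Longrightarrow> \<bar>f x\<bar> \<le> c"
  shows "dual_norm V N f \<le> c"
proof -
  have "0 \<in> V" using subspace subspace_0 by blast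
  moreover have "N 0 \<le> 1" using norm_eq_zero_iff[OF \<open>0 \<in> V\<close>] by simp
  ultimately show ?thesis
    unfolding dual_norm_def using assms by (intro cSup_least) auto
qed

lemma (in normed_space_on) dual_normed_space: "normed_space_on (dual_space V N) (dual_norm V N)"
proof
  have V0: "0 \<in> V" "\<And>c x. x \<in> V \<Longrightarrow> c *\<^sub>R x \<in> V" "\<And>x y. x \<in> V \<Longrightarrow> y \<in> V \<Longrightarrow> x + y \<in> V"
    using subspace by (auto simp: subspace_def)
  have N0: "N 0 = 0" using norm_eq_zero_iff[OF V0(1)] by simp
  have scale: "c *\<^sub>R f \<in> dual_space V N" if h: "f \<in> dual_space V N" for c f
  proof -
    obtain B where "\<forall>x\<in>V. \<bar>f x\<bar> \<le> B * N x" using dual_space_bounded[OF h] by blast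
    then have "\<forall>x\<in>V. \<bar>(c *\<^sub>R f) x\<bar> \<le> (\<bar>c\<bar> * B) * N x"
      by (simp add: abs_mult mult.assoc mult_left_mono)
    then have "\<exists>B. \<forall>x\<in>V. \<bar>(c *\<^sub>R f) x\<bar> \<le> B * N x" by blast
    then show ?thesis using h unfolding dual_space_def by (simp add: distrib_left)
  qed
  show "subspace (dual_space V N)"
    unfolding subspace_def
  proof (intro conjI ballI allI)
    show "0 \<in> dual_space V N" by (auto simp: dual_space_def N0 intro!: exI[of _ 0])
    fix f g assume f: "f \<in> dual_space V N" and g: "g \<in> dual_space V N"
    obtain B C where "\<forall>x\<in>V. \<bar>f x\<bar> \<le> B * N x" "\<forall>x\<in>V. \<bar>g x\<bar> \<le> C * N x"
      using dual_space_bounded[OF f] dual_space_bounded[OF g] by blast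
    then have "\<forall>x\<in>V. \<bar>(f + g) x\<bar> \<le> (B + C) * N x"
      by (auto simp: distrib_right intro: order_trans[OF abs_triangle_ineq add_mono])
    then have "\<exists>B. \<forall>x\<in>V. \<bar>(f + g) x\<bar> \<le> B * N x" by blast
    then show "f + g \<in> dual_space V N"
      using f g unfolding dual_space_def by (simp add: distrib_left)
  qed (use scale in auto)
  fix f assume f: "f \<in> dual_space V N"
  have f0: "f 0 = 0" using f V0(1) by (force simp: dual_space_def)
  show nonneg: "0 \<le> dual_norm V N f"
    using dual_apply_le[OF f V0(1)] f0 N0 by simp
  show "dual_norm V N f = 0 \<longleftrightarrow> f = 0"
  proof
    assume d: "dual_norm V N f = 0"
    show "f = 0"
    proof
      fix x
      show "f x = 0 x"
      proof (cases "x \<in> V \<and> x \<noteq> 0")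
        case True
        then have N: "N x > 0" using norm_nonneg[of x] norm_eq_zero_iff[of x] by force
        then have "\<bar>f ((1 / N x) *\<^sub>R x)\<bar> \<le> 0"
          using dual_apply_le[OF f V0(2)[of x "1 / N x"]] True norm_scaleR[of x "1 / N x"] d by simp
        then show ?thesis using f True N by (simp add: dual_space_def)
      qed (use f f0 in \<open>auto simp: dual_space_def\<close>)
    qed
  next
    assume "f = 0"
    then have "dual_norm V N f \<le> 0" by (intro dual_norm_leI) auto
    then show "dual_norm V N f = 0" using nonneg by simp
  qed
  have le: "dual_norm V N (c *\<^sub>R g) \<le> \<bar>c\<bar> * dual_norm V N g" if "g \<in> dual_space V N" for c g
    by (intro dual_norm_leI) (auto simp: abs_mult intro!: mult_left_mono dual_apply_le[OF that])
  show "dual_norm V N (c *\<^sub>R f) = \<bar>c\<bar> * dual_norm V N f" for c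
  proof (cases "c = 0")
    case True
    then show ?thesis using le[OF f, of 0] dual_apply_le[OF scale[OF f, of 0] V0(1)] N0 by simp
  next
    case False
    have "\<bar>c\<bar> * dual_norm V N ((1 / c) *\<^sub>R (c *\<^sub>R f)) \<le> \<bar>c\<bar> * (\<bar>1 / c\<bar> * dual_norm V N (c *\<^sub>R f))"
      by (intro mult_left_mono le scale f) auto
    then show ?thesis using le[OF f, of c] False by simp
  qed
  fix g assume g: "g \<in> dual_space V N"
  show "dual_norm V N (f + g) \<le> dual_norm V N f + dual_norm V N g"
    using dual_apply_le[OF f] dual_apply_le[OF g]
    by (intro dual_norm_leI) (fastforce intro: order_trans[OF abs_triangle_ineq add_mono])
qed

text \<open>Surjectivity of the canonical embedding into the bidual.\<close>

definition reflexive_space_on :: "'a::real_vector set \<Rightarrow> ('a \<Rightarrow> real) \<Rightarrow> bool" where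
  "reflexive_space_on V N \<longleftrightarrow>
     (\<forall>\<phi> \<in> dual_space (dual_space V N) (dual_norm V N).
        \<exists>x\<in>V. \<forall>f \<in> dual_space V N. \<phi> f = f x)"

definition bounded_seq_on :: "'a::real_vector set \<Rightarrow> ('a \<Rightarrow> real) \<Rightarrow> (nat \<Rightarrow> 'a) \<Rightarrow> bool" where
  "bounded_seq_on V N x \<longleftrightarrow> (\<forall>n. x n \<in> V) \<and> (\<exists>B. \<forall>n. N (x n) \<le> B)"

definition normalized_seq_on :: "'a::real_vector set \<Rightarrow> ('a \<Rightarrow> real) \<Rightarrow> (nat \<Rightarrow> 'a) \<Rightarrow> bool" where
  "normalized_seq_on V N x \<longleftrightarrow> (\<forall>n. x n \<in> V) \<and> (\<forall>n. N (x n) = 1)"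

definition weakly_null_on :: "'a::real_vector set \<Rightarrow> ('a \<Rightarrow> real) \<Rightarrow> (nat \<Rightarrow> 'a) \<Rightarrow> bool" where
  "weakly_null_on V N x \<longleftrightarrow>
     (\<forall>n. x n \<in> V) \<and> (\<forall>f \<in> dual_space V N. (\<lambda>n. f (x n)) \<longlonglongrightarrow> 0)"

text \<open>Principal ultrafilters are included.\<close>

definition ultrafilter :: "'a filter \<Rightarrow> bool" where
  "ultrafilter F \<longleftrightarrow>
     F \<noteq> bot \<and> (\<forall>P. eventually P F \<or> eventually (\<lambda>x. \<not> P x) F)"

text \<open>
  \<open>iterated_Lim U F [i\<^sub>1, \<dots>, i\<^sub>k] \<nu>\<close> is the iterated limit of \<open>F (n\<^sub>1, n\<^sub>2, \<dots>)\<close>, taken first along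
  \<open>U i\<^sub>k\<close> in the variable with index \<open>i\<^sub>k\<close> and last (outermost) along \<open>U i\<^sub>1\<close> in the variable with
  index \<open>i\<^sub>1\<close>; variables whose index is not listed keep their value under \<open>\<nu>\<close>.
\<close>

primrec iterated_Lim ::
  "(nat \<Rightarrow> nat filter) \<Rightarrow> ((nat \<Rightarrow> nat) \<Rightarrow> real) \<Rightarrow> nat list \<Rightarrow> (nat \<Rightarrow> nat) \<Rightarrow> real" where
  "iterated_Lim U F [] \<nu> = F \<nu>"
| "iterated_Lim U F (i # is) \<nu> = Lim (U i) (\<lambda>n. iterated_Lim U F is (\<nu>(i := n)))"

text \<open>
  The iterated limit over \<open>n\<^bsub>\<sigma>(1)\<^esub>, \<dots>, n\<^bsub>\<sigma>(m)\<^esub>\<close> of the norm of the sum of the \<open>x\<^sup>i\<close> at \<open>n\<^sub>i\<close>. All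
  variables that occur are bound by a limit, so the initial assignment \<open>\<lambda>_. 0\<close> is immaterial.
\<close>

definition iterated_norm_Lim ::
  "('a::real_vector \<Rightarrow> real) \<Rightarrow> nat \<Rightarrow> (nat \<Rightarrow> nat) \<Rightarrow> (nat \<Rightarrow> nat \<Rightarrow> 'a) \<Rightarrow> (nat \<Rightarrow> nat filter) \<Rightarrow> real"
  where
  "iterated_norm_Lim N m \<sigma> x U =
     iterated_Lim U (\<lambda>\<nu>. N (\<Sum>i=1..m. x i (\<nu> i))) (map \<sigma> [1..<Suc m]) (\<lambda>_. 0)"

definition asymptotically_symmetric_on :: "'a::real_vector set \<Rightarrow> ('a \<Rightarrow> real) \<Rightarrow> bool" where
  "asymptotically_symmetric_on V N \<longleftrightarrow>
     (\<exists>C::real. \<forall>m \<sigma> x U.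
        \<sigma> permutes {1..m} \<longrightarrow>
        (\<forall>i\<in>{1..m}. bounded_seq_on V N (x i)) \<longrightarrow>
        (\<forall>i\<in>{1..m}. ultrafilter (U i)) \<longrightarrow>
        iterated_norm_Lim N m id x U \<le> C * iterated_norm_Lim N m \<sigma> x U)"

end

theory Submission
  imports Defs "HOL-Analysis.L2_Norm" "HOL-Computational_Algebra.Primes"
begin

text \<open>
  The witness is a reflexive relative of Tzafriri's space, the space of all sequences for which the norm
  determined by \<open>\<parallel>x\<parallel> = max (sup\<^sub>n \<bar>x\<^sub>n\<bar>) (sup (1 / (3 \<surd>m)) \<Sum>\<^sub>i \<parallel>E\<^sub>i x\<parallel>)\<close>, the inner supremum running over all
  \<open>m\<close> and all finite families \<open>E\<^sub>1 < \<dots> < E\<^sub>m\<close> of successive sets of indices, is finite. Here \<open>E x\<close> is the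
  restriction of \<open>x\<close> to \<open>E\<close>. This norm sits between the norms of \<open>\<ell>\<^sub>2\<close> and \<open>c\<^sub>0\<close>, and it has an
  equal-norm lower \<open>2\<close>-estimate by construction without having a lower \<open>2\<close>-estimate; that gap is
  what the theorem exploits.

  Both estimates for successive blocks \<open>x\<^sub>1 < \<dots> < x\<^sub>k\<close> are short. Directly from the definition,
  \<open>\<parallel>\<Sum> x\<^sub>i\<parallel> \<ge> (1 / (3 \<surd>k)) \<Sum> \<parallel>x\<^sub>i\<parallel>\<close> (\<open>lower_estimate\<close>), and an induction on the construction of the
  functionals gives \<open>\<parallel>\<Sum> x\<^sub>i\<parallel> \<le> 2 (\<Sum> \<parallel>x\<^sub>i\<parallel>\<^sup>2)\<^sup>1\<^sup>/\<^sup>2\<close> (\<open>upper_estimate\<close>). Hence \<open>k\<close> normalized blocks always have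
  norm of order \<open>\<surd>k\<close>. Weakly null sequences become blocks after small perturbations, so the iterated
  limits of \<open>k\<close> normalized weakly null sequences, in whatever order, are of order \<open>\<surd>k\<close>. A principal
  ultrafilter only contributes a fixed vector; if \<open>y\<close> is the sum of these vectors, the iterated limits
  are all of order \<open>max \<parallel>y\<parallel> \<surd>k\<close> (\<open>iterated_norm_estimate\<close>). This gives the positive half of the
  theorem with \<open>C = 14\<close>.

  The two estimates also give reflexivity. By the lower one the tails of every element tend to \<open>0\<close>, and
  by the upper one every functional is the norm limit of its restrictions to the first \<open>n\<close> coordinates.
  So an element of the bidual is determined by its values at the coordinate functionals, and these
  values form an element of the space because the norm is a supremum of finitely supported functionals.

  Weights spoil symmetry. Take \<open>2\<^sup>l\<close> coefficients \<open>2\<^sup>-\<^sup>l\<^sup>/\<^sup>2\<close> for each level \<open>l < L\<close>, so that every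
  level has norm at least \<open>1/3\<close>. If the levels follow one another, the lower estimate yields norm at least
  \<open>\<surd>L / 9\<close> (\<open>level_order_lower\<close>). If instead the coefficients are arranged as the in-order
  traversal of a binary tree, that is, as the lengths of the marks on a ruler, then every interval
  has one dominating coefficient and is otherwise so thin that splitting it never pays: the norm is just
  the largest coefficient (\<open>ruler_order_upper\<close>). The ratio of the two norms tends to
  infinity with \<open>L\<close>. Each of these arrangements is the iterated limit, for a suitable order of the
  variables, of the same multiples of the unit vector basis.
\<close>

section \<open>Admissible functionals and the norm\<close>

definition successive :: "nat set \<Rightarrow> (nat \<Rightarrow> nat set) \<Rightarrow> bool" where
  "successive I T \<longleftrightarrow> (\<forall>i\<in>I. \<forall>j\<in>I. i < j \<longrightarrow> (\<forall>p\<in>T i. \<forall>q\<in>T j. p < q))"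

lemma successiveD:
  "successive I T \<Longrightarrow> i \<in> I \<Longrightarrow> j \<in> I \<Longrightarrow> i < j \<Longrightarrow> p \<in> T i \<Longrightarrow> q \<in> T j \<Longrightarrow> p < q"
  unfolding successive_def by blast

lemma successive_subset:
  assumes "successive I T" "I' \<subseteq> I" "\<And>i. i \<in> I' \<Longrightarrow> T' i \<subseteq> T i"
  shows "successive I' T'"
  unfolding successive_def using successiveD[OF assms(1)] assms(2,3) by (meson subsetD)

lemma successive_empty: "successive {} T"
  by (simp add: successive_def)

text \<open>
  The relation says that \<open>r\<close> is the value at \<open>\<bar>x\<bar>\<close> of one of the functionals that define the
  norm, supported in \<open>S\<close>. Keeping the vector fixed and recording only the values avoids a separate
  syntax of functionals; letting \<open>S\<close> be an arbitrary set makes restrictions of vectors and subfamilies of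
  blocks available without any bookkeeping. The empty family is allowed and contributes the value \<open>0\<close>.
\<close>

inductive val :: "(nat \<Rightarrow> real) \<Rightarrow> nat set \<Rightarrow> real \<Rightarrow> bool" for x where
  unit: "n \<in> S \<Longrightarrow> val x S \<bar>x n\<bar>"
| comb: "finite I \<Longrightarrow> \<forall>i\<in>I. T i \<subseteq> S \<Longrightarrow>
    successive I T \<Longrightarrow>
    \<forall>i\<in>I. val x (T i) (r i) \<Longrightarrow>
    val x S ((\<Sum>i\<in>(I::nat set). r i) / (3 * sqrt (real (card I))))"

text \<open>
  The norm of the restriction of \<open>x\<close> to \<open>S\<close>. The supremum is meaningful only if it is finite, so
  most facts below assume that \<open>x\<close> lies in the space.
\<close>

definition nrm :: "(nat \<Rightarrow> real) \<Rightarrow> nat set \<Rightarrow> real" where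
  "nrm x S = Sup {r. val x S r}"

text \<open>
  All sequences of finite norm, which makes completeness and the representation of bidual elements easy; by
  \<open>tail_tendsto\<close> below this is no larger than the closure of the finitely supported sequences.
\<close>

definition Tz :: "(nat \<Rightarrow> real) set" where
  "Tz = {x. \<exists>B. \<forall>r. val x UNIV r \<longrightarrow> r \<le> B}"

definition tz_norm :: "(nat \<Rightarrow> real) \<Rightarrow> real" where
  "tz_norm x = nrm x UNIV"

lemma val_zero: "val x S 0"
  using comb[of "{}" "\<lambda>_. {}" S x "\<lambda>_. 0"] by (simp add: successive_empty)

lemma val_mono: "val x S r \<Longrightarrow> S \<subseteq> S' \<Longrightarrow> val x S' r"
proof (induction rule: val.induct)
  case (unit n S) then show ?case using val.unit by blast
next
  case (comb I T S r)
  show ?case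
  proof (rule val.comb[OF comb(1)])
    show "\<forall>i\<in>I. T i \<subseteq> S'" using comb.hyps(2) comb.prems by blast
    show "successive I T" by (rule comb.hyps(3))
    show "\<forall>i\<in>I. val x (T i) (r i)" using comb.IH by simp
  qed
qed

text \<open>
  Each value comes from a nonnegative, finitely supported functional that is independent of the vector.
  Hence the norm is a supremum of functionals applied to \<open>\<bar>x\<bar>\<close>, and the triangle inequality, homogeneity and
  lower semicontinuity under coordinatewise convergence follow without further inductions.
\<close>

lemma val_functional:
  assumes "val x S r"
  shows "\<exists>F f. finite F \<and> F \<subseteq> S \<and> (\<forall>p. 0 \<le> f p) \<and> r = (\<Sum>p\<in>F. f p * \<bar>x p\<bar>) \<and>
           (\<forall>y. val y S (\<Sum>p\<in>F. f p * \<bar>y p\<bar>))"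
  using assms
proof (induction rule: val.induct)
  case (unit n S)
  show ?case
    by (rule exI[of _ "{n}"], rule exI[of _ "\<lambda>_. 1"]) (use unit val.unit in auto)
next
  case (comb I T S r)
  define Q where "Q = (\<lambda>i F f. finite F \<and> F \<subseteq> T i \<and> (\<forall>p. 0 \<le> f p) \<and> r i = (\<Sum>p\<in>F. f p * \<bar>x p\<bar>) \<and>
           (\<forall>y. val y (T i) (\<Sum>p\<in>F. f p * \<bar>y p\<bar>)))"
  have "\<forall>i\<in>I. \<exists>F f. Q i F f" using comb(4) unfolding Q_def by blast
  then obtain F f where "\<And>i. i \<in> I \<Longrightarrow> Q i (F i) (f i)" by metis
  then have F: "\<And>i. i \<in> I \<Longrightarrow> finite (F i) \<and> F i \<subseteq> T i \<and> (\<forall>p. 0 \<le> f i p) \<and>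
      r i = (\<Sum>p\<in>F i. f i p * \<bar>x p\<bar>) \<and> (\<forall>y. val y (T i) (\<Sum>p\<in>F i. f i p * \<bar>y p\<bar>))"
    unfolding Q_def by blast
  let ?c = "3 * sqrt (real (card I))"
  let ?g = "\<lambda>p. (\<Sum>i\<in>I. if p \<in> F i then f i p else 0) / ?c"
  have eq: "(\<Sum>p\<in>\<Union>(F ` I). ?g p * \<bar>y p\<bar>) = (\<Sum>i\<in>I. \<Sum>p\<in>F i. f i p * \<bar>y p\<bar>) / ?c" for y :: "nat \<Rightarrow> real"
  proof -
    have "(\<Sum>p\<in>\<Union>(F ` I). ?g p * \<bar>y p\<bar>)
        = (\<Sum>p\<in>\<Union>(F ` I). (\<Sum>i\<in>I. if p \<in> F i then f i p * \<bar>y p\<bar> else 0)) / ?c"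
      by (simp add: sum_divide_distrib sum_distrib_right if_distrib[of "\<lambda>t. t * _"] cong: if_cong)
    also have "(\<Sum>p\<in>\<Union>(F ` I). (\<Sum>i\<in>I. if p \<in> F i then f i p * \<bar>y p\<bar> else 0))
        = (\<Sum>i\<in>I. \<Sum>p\<in>\<Union>(F ` I). if p \<in> F i then f i p * \<bar>y p\<bar> else 0)"
      by (rule sum.swap)
    also have "\<dots> = (\<Sum>i\<in>I. \<Sum>p\<in>F i. f i p * \<bar>y p\<bar>)"
    proof (rule sum.cong[OF refl])
      fix i assume i: "i \<in> I"
      have "finite (\<Union>(F ` I))" using F comb(1) by auto
      then show "(\<Sum>p\<in>\<Union>(F ` I). if p \<in> F i then f i p * \<bar>y p\<bar> else 0) = (\<Sum>p\<in>F i. f i p * \<bar>y p\<bar>)"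
        using i by (intro sum.mono_neutral_cong_right) auto
    qed
    finally show ?thesis .
  qed
  show ?case
  proof (intro exI conjI allI)
    show "finite (\<Union>(F ` I))" using F comb(1) by auto
    show "\<Union>(F ` I) \<subseteq> S" using F comb(2) by blast
    show "0 \<le> ?g p" for p using F by (intro divide_nonneg_nonneg sum_nonneg) auto
    show "(\<Sum>i\<in>I. r i) / ?c = (\<Sum>p\<in>\<Union>(F ` I). ?g p * \<bar>x p\<bar>)"
      unfolding eq using F by simp
    show "val y S (\<Sum>p\<in>\<Union>(F ` I). ?g p * \<bar>y p\<bar>)" for y
      unfolding eq
    proof (rule val.comb[OF comb(1-3)])
      show "\<forall>i\<in>I. val y (T i) (\<Sum>p\<in>F i. f i p * \<bar>y p\<bar>)" using F by simp
    qed
  qed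
qed

lemma val_empty: "val x {} r \<Longrightarrow> r = 0"
  by (drule val_functional) auto

lemma val_finite_support:
  assumes "val x S r" shows "\<exists>F. finite F \<and> F \<subseteq> S \<and> val x F r"
  using assms
proof (induction rule: val.induct)
  case (unit n S) then show ?case by (intro exI[of _ "{n}"]) (auto intro: val.unit)
next
  case (comb I T S r)
  have "\<forall>i\<in>I. \<exists>F. finite F \<and> F \<subseteq> T i \<and> val x F (r i)" using comb(4) by simp
  from bchoice[OF this] obtain F
    where F: "\<forall>i\<in>I. finite (F i) \<and> F i \<subseteq> T i \<and> val x (F i) (r i)" by blast
  have "val x (\<Union>(F ` I)) ((\<Sum>i\<in>I. r i) / (3 * sqrt (real (card I))))"
  proof (rule val.comb[of I F])
    show "successive I F"
      using F by (intro successive_subset[OF comb(3)]) auto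
  qed (use F comb(1) in auto)
  then show ?case using F comb(1,2) by (intro exI[of _ "\<Union>(F ` I)"]) (simp, blast)
qed

lemma val_abs_cong:
  assumes "val x S r" "\<And>n. n \<in> S \<Longrightarrow> \<bar>y n\<bar> = \<bar>x n\<bar>" shows "val y S r"
proof -
  obtain F f where "F \<subseteq> S" "r = (\<Sum>p\<in>F. f p * \<bar>x p\<bar>)" "val y S (\<Sum>p\<in>F. f p * \<bar>y p\<bar>)"
    using val_functional[OF assms(1)] by blast
  moreover have "(\<Sum>p\<in>F. f p * \<bar>x p\<bar>) = (\<Sum>p\<in>F. f p * \<bar>y p\<bar>)"
    by (rule sum.cong) (use assms(2) calculation(1) in auto)
  ultimately show ?thesis by simp
qed

definition cut :: "nat set \<Rightarrow> (nat \<Rightarrow> real) \<Rightarrow> nat \<Rightarrow> real" where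
  "cut S x = (\<lambda>n. if n \<in> S then x n else 0)"

lemma cut_apply [simp]: "cut S x n = (if n \<in> S then x n else 0)"
  by (simp add: cut_def)

lemma val_cut: "val (cut S x) T r \<longleftrightarrow> val x (T \<inter> S) r"
proof
  assume "val (cut S x) T r"
  then show "val x (T \<inter> S) r"
  proof (induction rule: val.induct)
    case (unit n T)
    then show ?case using val.unit[of n "T \<inter> S" x] val_zero by auto
  next
    case (comb I U T r)
    have "\<forall>i\<in>I. val x (U i \<inter> S) (r i)" using comb(4) by simp
    moreover have "\<forall>i\<in>I. U i \<inter> S \<subseteq> T \<inter> S" using comb(2) by blast
    moreover have "successive I (\<lambda>i. U i \<inter> S)"
      by (rule successive_subset[OF comb(3)]) auto
    ultimately show ?case
      using val.comb[OF comb(1), of "\<lambda>i. U i \<inter> S" "T \<inter> S" x r] by simp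
  qed
next
  assume "val x (T \<inter> S) r"
  then have "val (cut S x) (T \<inter> S) r" by (rule val_abs_cong) auto
  then show "val (cut S x) T r" by (rule val_mono) auto
qed

lemma nrm_cut: "nrm (cut S x) T = nrm x (T \<inter> S)"
  by (simp add: nrm_def val_cut)

lemma tz_norm_cut: "tz_norm (cut S x) = nrm x S"
  by (simp add: tz_norm_def nrm_cut)

lemma val_bounded: "x \<in> Tz \<Longrightarrow> \<exists>B. \<forall>S r. val x S r \<longrightarrow> r \<le> B"
  unfolding Tz_def using val_mono by blast

lemma val_le_nrm:
  assumes "x \<in> Tz" "val x S r" shows "r \<le> nrm x S"
proof -
  obtain B where "\<And>S r. val x S r \<Longrightarrow> r \<le> B" using val_bounded[OF assms(1)] by blast
  then have "bdd_above {r. val x S r}" by (intro bdd_aboveI[of _ B]) auto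
  then show ?thesis unfolding nrm_def using assms(2) by (intro cSup_upper) auto
qed

lemma nrm_le: "(\<And>r. val x S r \<Longrightarrow> r \<le> B) \<Longrightarrow> nrm x S \<le> B"
  unfolding nrm_def using val_zero by (intro cSup_least) auto

lemma less_nrm: "x \<in> Tz \<Longrightarrow> e < nrm x S \<Longrightarrow> \<exists>r. val x S r \<and> e < r"
  using nrm_le[of x S e] by force

lemma nrm_nonneg: "x \<in> Tz \<Longrightarrow> 0 \<le> nrm x S"
  by (rule val_le_nrm[OF _ val_zero])

lemma nrm_mono: "x \<in> Tz \<Longrightarrow> S \<subseteq> S' \<Longrightarrow> nrm x S \<le> nrm x S'"
  by (rule nrm_le) (blast intro: val_le_nrm val_mono)

lemma nrm_empty: "x \<in> Tz \<Longrightarrow> nrm x {} = 0"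
  using nrm_le[of x "{}" 0] nrm_nonneg[of x "{}"] val_empty by force

lemma Tz_I: "(\<And>r. val x UNIV r \<Longrightarrow> r \<le> B) \<Longrightarrow> x \<in> Tz"
  unfolding Tz_def by blast

lemma cut_Tz: "x \<in> Tz \<Longrightarrow> cut S x \<in> Tz"
  by (rule Tz_I[of _ "nrm x S"]) (simp add: val_cut val_le_nrm)

lemma abs_le_nrm: "x \<in> Tz \<Longrightarrow> n \<in> S \<Longrightarrow> \<bar>x n\<bar> \<le> nrm x S"
  by (rule val_le_nrm[OF _ val.unit])

lemma val_add:
  assumes "val (x + y) S r"
  obtains s t where "val x S s" "val y S t" "r \<le> s + t"
proof -
  obtain F f where f: "\<And>p. 0 \<le> f p" "r = (\<Sum>p\<in>F. f p * \<bar>(x + y) p\<bar>)"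
      "\<And>z. val z S (\<Sum>p\<in>F. f p * \<bar>z p\<bar>)"
    using val_functional[OF assms] by blast
  have "r \<le> (\<Sum>p\<in>F. f p * \<bar>x p\<bar> + f p * \<bar>y p\<bar>)"
    unfolding f(2) by (intro sum_mono) (auto simp: distrib_left[symmetric] intro!: mult_left_mono f(1))
  then show ?thesis using that[OF f(3) f(3)] by (simp add: sum.distrib)
qed

lemma val_add_le:
  assumes "x \<in> Tz" "y \<in> Tz" "val (x + y) S r" shows "r \<le> nrm x S + nrm y S"
proof -
  obtain s t where "val x S s" "val y S t" "r \<le> s + t" using val_add[OF assms(3)] by blast
  then show ?thesis using val_le_nrm[OF assms(1), of S s] val_le_nrm[OF assms(2), of S t] by simp
qed

lemma add_Tz: "x \<in> Tz \<Longrightarrow> y \<in> Tz \<Longrightarrow> x + y \<in> Tz"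
  by (rule Tz_I[of _ "nrm x UNIV + nrm y UNIV"]) (rule val_add_le)

lemma nrm_add: "x \<in> Tz \<Longrightarrow> y \<in> Tz \<Longrightarrow> nrm (x + y) S \<le> nrm x S + nrm y S"
  by (rule nrm_le) (rule val_add_le)

lemma val_of_scale:
  assumes "val (c *\<^sub>R x) S r" obtains s where "val x S s" "r = \<bar>c\<bar> * s"
proof -
  obtain F f where "r = (\<Sum>p\<in>F. f p * \<bar>(c *\<^sub>R x) p\<bar>)" "val x S (\<Sum>p\<in>F. f p * \<bar>x p\<bar>)"
    using val_functional[OF assms] by blast
  then show ?thesis using that[of "\<Sum>p\<in>F. f p * \<bar>x p\<bar>"] by (simp add: sum_distrib_left abs_mult mult_ac)
qed

lemma val_scale_le:
  assumes "x \<in> Tz" "val (c *\<^sub>R x) S r" shows "r \<le> \<bar>c\<bar> * nrm x S"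
proof -
  obtain s where "val x S s" "r = \<bar>c\<bar> * s" using val_of_scale[OF assms(2)] by blast
  then show ?thesis using val_le_nrm[OF assms(1), of S s] by (simp add: mult_left_mono)
qed

lemma scale_Tz: "x \<in> Tz \<Longrightarrow> c *\<^sub>R x \<in> Tz"
  by (rule Tz_I[of _ "\<bar>c\<bar> * nrm x UNIV"]) (rule val_scale_le)

lemma nrm_scale_le: "x \<in> Tz \<Longrightarrow> nrm (c *\<^sub>R x) S \<le> \<bar>c\<bar> * nrm x S"
  by (rule nrm_le) (rule val_scale_le)

lemma nrm_scale:
  assumes "x \<in> Tz" shows "nrm (c *\<^sub>R x) S = \<bar>c\<bar> * nrm x S"
proof (cases "c = 0")
  case True
  then show ?thesis using nrm_scale_le[OF assms, of c S] nrm_nonneg[OF scale_Tz[OF assms, of c], of S] by simp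
next
  case False
  have "\<bar>c\<bar> * nrm ((1/c) *\<^sub>R (c *\<^sub>R x)) S \<le> \<bar>c\<bar> * (\<bar>1/c\<bar> * nrm (c *\<^sub>R x) S)"
    by (intro mult_left_mono nrm_scale_le scale_Tz assms) auto
  then show ?thesis using nrm_scale_le[OF assms, of c S] False by simp
qed

lemma subspace_Tz: "subspace Tz"
  unfolding subspace_def
proof (intro conjI ballI allI)
  show "0 \<in> Tz"
  proof (rule Tz_I)
    fix r assume "val 0 UNIV r"
    then show "r \<le> 0" using val_functional[of 0 UNIV r] by auto
  qed
qed (auto intro: add_Tz scale_Tz)

lemma normed_Tz: "normed_space_on Tz tz_norm"
proof
  show "tz_norm x = 0 \<longleftrightarrow> x = 0" if x: "x \<in> Tz" for x
  proof
    assume "tz_norm x = 0"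
    then show "x = 0" using abs_le_nrm[OF x, of _ UNIV] by (auto simp: tz_norm_def fun_eq_iff)
  next
    assume "x = 0"
    then show "tz_norm x = 0" using nrm_scale[OF x, of 0 UNIV] by (simp add: tz_norm_def)
  qed
qed (auto simp: tz_norm_def subspace_Tz nrm_nonneg nrm_scale nrm_add)

interpretation Tz: normed_space_on Tz tz_norm by (rule normed_Tz)

lemma diff_Tz: "x \<in> Tz \<Longrightarrow> y \<in> Tz \<Longrightarrow> x - y \<in> Tz"
  by (rule subspace_diff[OF subspace_Tz])

lemma sum_Tz: "(\<And>i. i \<in> I \<Longrightarrow> x i \<in> Tz) \<Longrightarrow> (\<Sum>i\<in>I. x i) \<in> Tz"
  by (rule subspace_sum[OF subspace_Tz])

text \<open>
  Lower semicontinuity in a form that keeps the functional fixed along the sequence; completeness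
  rests on it, since Cauchy sequences are only seen to converge coordinatewise at first.
\<close>

lemma val_tendsto:
  assumes "val x S r" "\<And>n. (\<lambda>k. X k n) \<longlonglongrightarrow> x n"
  obtains \<rho> where "\<And>k. val (X k) S (\<rho> k)" "\<rho> \<longlonglongrightarrow> r"
proof -
  obtain F f where f: "r = (\<Sum>p\<in>F. f p * \<bar>x p\<bar>)" "\<And>z. val z S (\<Sum>p\<in>F. f p * \<bar>z p\<bar>)"
    using val_functional[OF assms(1)] by blast
  have "(\<lambda>k. \<Sum>p\<in>F. f p * \<bar>X k p\<bar>) \<longlonglongrightarrow> r"
    unfolding f(1) by (intro tendsto_intros assms(2))
  then show ?thesis using f(2) that[of "\<lambda>k. \<Sum>p\<in>F. f p * \<bar>X k p\<bar>"] by blast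
qed

lemma banach_Tz: "banach_space_on Tz tz_norm"
proof (intro banach_space_on.intro normed_Tz banach_space_on_axioms.intro)
  fix X :: "nat \<Rightarrow> nat \<Rightarrow> real"
  assume X: "\<And>n. X n \<in> Tz" and C: "\<And>e. 0 < e \<Longrightarrow> \<exists>M. \<forall>m\<ge>M. \<forall>n\<ge>M. tz_norm (X m - X n) < e"
  have "Cauchy (\<lambda>k. X k n)" for n
  proof (rule metric_CauchyI)
    fix e :: real assume "0 < e"
    then obtain M where M: "\<forall>m\<ge>M. \<forall>n\<ge>M. tz_norm (X m - X n) < e" using C by blast
    have "dist (X i n) (X j n) < e" if "i \<ge> M" "j \<ge> M" for i j
      using M that abs_le_nrm[OF diff_Tz[OF X[of i] X[of j]], of n UNIV]
      by (force simp: dist_real_def tz_norm_def)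
    then show "\<exists>M. \<forall>m\<ge>M. \<forall>k\<ge>M. dist (X m n) (X k n) < e" by blast
  qed
  then have "\<exists>l. (\<lambda>k. X k n) \<longlonglongrightarrow> l" for n by (simp add: Cauchy_convergent_iff convergent_def)
  then obtain L where L: "\<And>n. (\<lambda>k. X k n) \<longlonglongrightarrow> L n" by metis
  have close: "\<exists>M. \<forall>m\<ge>M. \<forall>r. val (X m - L) UNIV r \<longrightarrow> r \<le> e" if "0 < e" for e
  proof -
    obtain M where M: "\<forall>m\<ge>M. \<forall>n\<ge>M. tz_norm (X m - X n) < e" using C \<open>0 < e\<close> by blast
    have "r \<le> e" if m: "m \<ge> M" and r: "val (X m - L) UNIV r" for m r
    proof -
      have "(\<lambda>k. (X m - X k) n) \<longlonglongrightarrow> (X m - L) n" for n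
        by (auto intro!: tendsto_intros L)
      then obtain \<rho> where \<rho>: "\<And>k. val (X m - X k) UNIV (\<rho> k)" "\<rho> \<longlonglongrightarrow> r"
        using val_tendsto[OF r, of "\<lambda>k. X m - X k"] by blast
      have "\<rho> k \<le> e" if "k \<ge> M" for k
        using val_le_nrm[OF diff_Tz[OF X X] \<rho>(1)[of k]] M m that by (force simp: tz_norm_def)
      then show ?thesis by (intro LIMSEQ_le_const2[OF \<rho>(2)]) blast
    qed
    then show ?thesis by blast
  qed
  obtain M where M: "\<forall>m\<ge>M. \<forall>r. val (X m - L) UNIV r \<longrightarrow> r \<le> 1" using close[of 1] by auto
  have "X M - L \<in> Tz" using M by (intro Tz_I[of _ 1]) auto
  then have "X M - (X M - L) \<in> Tz" by (rule diff_Tz[OF X])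
  moreover have "X M - (X M - L) = L" by (simp add: fun_eq_iff)
  ultimately have LT: "L \<in> Tz" by metis
  have "(\<lambda>n. tz_norm (X n - L)) \<longlonglongrightarrow> 0"
  proof (rule LIMSEQ_I)
    fix e :: real assume "0 < e"
    then obtain M where M: "\<forall>m\<ge>M. \<forall>r. val (X m - L) UNIV r \<longrightarrow> r \<le> e/2" using close[of "e/2"] by auto
    have "norm (tz_norm (X m - L) - 0) < e" if "m \<ge> M" for m
      using nrm_le[of "X m - L" UNIV "e/2"] M that nrm_nonneg[OF diff_Tz[OF X LT], of m UNIV] \<open>0 < e\<close>
      by (auto simp: tz_norm_def)
    then show "\<exists>M. \<forall>m\<ge>M. norm (tz_norm (X m - L) - 0) < e" by blast
  qed
  then show "\<exists>L\<in>Tz. (\<lambda>n. tz_norm (X n - L)) \<longlonglongrightarrow> 0" using LT by blast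
qed

section \<open>Estimates for successive blocks\<close>

text \<open>
  The rule \<open>comb\<close> passes from the functionals to the suprema: choose functionals on the blocks that are
  norming up to an error.
\<close>

lemma lower_estimate:
  assumes x: "x \<in> Tz" and "finite I" "\<And>i. i \<in> I \<Longrightarrow> T i \<subseteq> S" "successive I T"
  shows "(\<Sum>i\<in>I. nrm x (T i)) / (3 * sqrt (real (card I))) \<le> nrm x S"
proof (cases "I = {}")
  case True
  then show ?thesis using nrm_nonneg[OF x] by simp
next
  case False
  let ?c = "3 * sqrt (real (card I))"
  have c: "0 < ?c" using False assms(2) by (simp add: card_gt_0_iff)
  have "(\<Sum>i\<in>I. nrm x (T i)) \<le> ?c * nrm x S + e" if "0 < e" for e
  proof -
    define d where "d = e / card I"
    have d: "0 < d" using that False assms(2) by (simp add: d_def card_gt_0_iff)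
    have "\<forall>i\<in>I. \<exists>r. val x (T i) r \<and> nrm x (T i) - d < r"
      using less_nrm[OF x] d by simp
    from bchoice[OF this] obtain r
      where r: "\<forall>i\<in>I. val x (T i) (r i) \<and> nrm x (T i) - d < r i" by blast
    have "val x S ((\<Sum>i\<in>I. r i) / ?c)"
      by (rule val.comb[OF assms(2) _ assms(4)]) (use r assms(3) in auto)
    then have "(\<Sum>i\<in>I. r i) / ?c \<le> nrm x S" by (rule val_le_nrm[OF x])
    then have "(\<Sum>i\<in>I. r i) \<le> ?c * nrm x S" using c by (simp add: pos_divide_le_eq mult.commute)
    moreover have "(\<Sum>i\<in>I. nrm x (T i)) \<le> (\<Sum>i\<in>I. r i + d)"
      using r by (intro sum_mono) (auto simp: algebra_simps less_imp_le)
    moreover have "(\<Sum>i\<in>I. r i + d) = (\<Sum>i\<in>I. r i) + e"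
      using False assms(2) by (simp add: sum.distrib d_def)
    ultimately show ?thesis by simp
  qed
  then have "(\<Sum>i\<in>I. nrm x (T i)) \<le> ?c * nrm x S" by (rule field_le_epsilon)
  then show ?thesis using c by (simp add: pos_divide_le_eq mult.commute)
qed

lemma lower_estimate_const:
  assumes x: "x \<in> Tz" and I: "finite I" "\<And>i. i \<in> I \<Longrightarrow> T i \<subseteq> S" "successive I T"
    and t: "\<And>i. i \<in> I \<Longrightarrow> t \<le> nrm x (T i)"
  shows "t * sqrt (real (card I)) / 3 \<le> nrm x S"
proof -
  have "t * sqrt (card I) / 3 = t * card I / (3 * sqrt (card I))"
    by (cases "card I = 0") (auto simp: field_simps)
  also have "\<dots> \<le> (\<Sum>i\<in>I. nrm x (T i)) / (3 * sqrt (real (card I)))"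
    using sum_mono[of I "\<lambda>_. t" "\<lambda>i. nrm x (T i)"] t by (intro divide_right_mono) (auto simp: mult.commute)
  also have "\<dots> \<le> nrm x S" by (rule lower_estimate[OF x I])
  finally show ?thesis .
qed

lemma sum_mult_le_sqrt:
  fixes a b :: "'a \<Rightarrow> real"
  shows "(\<Sum>i\<in>I. a i * b i) \<le> sqrt (\<Sum>i\<in>I. (a i)\<^sup>2) * sqrt (\<Sum>i\<in>I. (b i)\<^sup>2)"
proof -
  have "(\<Sum>i\<in>I. a i * b i) \<le> (\<Sum>i\<in>I. \<bar>a i\<bar> * \<bar>b i\<bar>)"
    by (rule sum_mono) (metis abs_ge_self abs_mult)
  also have "\<dots> \<le> sqrt (\<Sum>i\<in>I. (a i)\<^sup>2) * sqrt (\<Sum>i\<in>I. (b i)\<^sup>2)"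
    using L2_set_mult_ineq[of a b I] by (simp add: L2_set_def)
  finally show ?thesis .
qed

lemma sum_le_sqrt_card:
  fixes a :: "'a \<Rightarrow> real"
  shows "(\<Sum>i\<in>I. a i) \<le> sqrt (card I) * sqrt (\<Sum>i\<in>I. (a i)\<^sup>2)"
  using sum_mult_le_sqrt[of "\<lambda>_. 1" a I] by simp

text \<open>
  Induction over the functionals. In the step \<open>r = (1 / (3 \<surd>\<bar>I\<bar>)) \<Sum>\<^sub>l r\<^sub>l\<close>, split the parts \<open>T\<^sub>l\<close> of the
  functional according to whether they meet one block or several. The parts inside a single block \<open>D\<^sub>i\<close>
  combine to a functional on \<open>D\<^sub>i\<close>, so they cost \<open>3 \<surd>g\<^sub>i \<parallel>D\<^sub>i x\<parallel>\<close>, where \<open>g\<^sub>i\<close> is their number;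
  Cauchy-Schwarz sums this up. To the other parts the induction hypothesis applies, and it
  loses only a factor \<open>\<surd>2\<close>, because a block meets at most two of them: any part between two parts that meet
  \<open>D\<^sub>i\<close> lies within \<open>D\<^sub>i\<close>. The constant \<open>2\<close> is consistent since
  \<open>(3 + 2 \<surd>2) / 3 \<le> 2\<close>.
\<close>

lemma upper_estimate_val:
  assumes x: "x \<in> Tz" and D: "successive {..<k} D" and v: "val x S r" and S: "S \<subseteq> (\<Union>i<k. D i)"
  shows "r \<le> 2 * sqrt (\<Sum>i<k. (nrm x (S \<inter> D i))\<^sup>2)"
  using v S
proof (induction rule: val.induct)
  case (unit n S)
  then obtain i where i: "i < k" "n \<in> D i" by blast
  have "\<bar>x n\<bar> \<le> nrm x (S \<inter> D i)" using abs_le_nrm[OF x] unit i by simp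
  also have "\<dots> = sqrt ((nrm x (S \<inter> D i))\<^sup>2)" using nrm_nonneg[OF x] by simp
  also have "\<dots> \<le> sqrt (\<Sum>i<k. (nrm x (S \<inter> D i))\<^sup>2)"
    by (intro real_sqrt_le_mono member_le_sum) (use i in auto)
  also have "\<dots> \<le> 2 * sqrt (\<Sum>i<k. (nrm x (S \<inter> D i))\<^sup>2)" by (simp add: sum_nonneg)
  finally show ?case .
next
  case (comb I T S r)
  define K where "K l = {i\<in>{..<k}. T l \<inter> D i \<noteq> {}}" for l
  define \<Sigma> where "\<Sigma> = (\<Sum>i<k. (nrm x (S \<inter> D i))\<^sup>2)"
  define G where "G i = {l\<in>I. K l = {i}}" for i
  \<comment> \<open>\<open>G i\<close> collects the parts that meet only the block \<open>D i\<close>, and \<open>J\<close> those that meet several.\<close>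
  define J where "J = {l\<in>I. K l \<noteq> {} \<and> (\<forall>i. K l \<noteq> {i})}"
  have \<Sigma>0: "0 \<le> \<Sigma>" unfolding \<Sigma>_def by (rule sum_nonneg) auto
  have T_cover: "T l \<subseteq> (\<Union>i\<in>K l. D i)" if "l \<in> I" for l
  proof
    fix p assume p: "p \<in> T l"
    then have "p \<in> S" using that comb.hyps(2) by auto
    then obtain i where "i < k" "p \<in> D i" using comb.prems by auto
    then show "p \<in> (\<Union>i\<in>K l. D i)" using p by (auto simp: K_def)
  qed
  have T_sub: "T l \<subseteq> S" if "l \<in> I" for l using that comb.hyps(2) by simp
  have IH: "r l \<le> 2 * sqrt (\<Sum>i<k. (nrm x (T l \<inter> D i))\<^sup>2)" if "l \<in> I" for l
    using comb.IH comb.prems T_sub[OF that] that by simp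
  have vT: "val x (T l) (r l)" if "l \<in> I" for l using comb.IH that by simp
  have finG: "finite (G i)" for i using comb.hyps(1) by (simp add: G_def)
  have finJ: "finite J" using comb.hyps(1) by (simp add: J_def)
  have split: "(\<Sum>l\<in>I. r l) = (\<Sum>i<k. \<Sum>l\<in>G i. r l) + (\<Sum>l\<in>J. r l)"
  proof -
    have "r l = 0" if "l \<in> I" "K l = {}" for l
      using T_cover[OF that(1)] that(2) vT[OF that(1)] val_empty[of x "r l"] by simp
    then have "(\<Sum>l\<in>I. r l) = (\<Sum>l\<in>(\<Union>i<k. G i) \<union> J. r l)"
      using comb.hyps(1) by (intro sum.mono_neutral_right) (auto simp: G_def J_def K_def)
    also have "\<dots> = (\<Sum>l\<in>(\<Union>i<k. G i). r l) + (\<Sum>l\<in>J. r l)"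
      by (rule sum.union_disjoint) (auto simp: finG finJ, auto simp: G_def J_def)
    also have "(\<Sum>l\<in>(\<Union>i<k. G i). r l) = (\<Sum>i<k. \<Sum>l\<in>G i. r l)"
      by (rule sum.UNION_disjoint) (auto simp: finG, auto simp: G_def)
    finally show ?thesis .
  qed
  have one: "(\<Sum>l\<in>G i. r l) \<le> 3 * (sqrt (card (G i)) * nrm x (S \<inter> D i))" for i
  proof (cases "G i = {}")
    case False
    then have c: "0 < 3 * sqrt (real (card (G i)))" using finG by (simp add: card_gt_0_iff)
    have "val x (S \<inter> D i) ((\<Sum>l\<in>G i. r l) / (3 * sqrt (real (card (G i)))))"
    proof (rule val.comb[OF finG])
      show "\<forall>l\<in>G i. T l \<subseteq> S \<inter> D i" using T_cover T_sub unfolding G_def by fastforce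
      show "successive (G i) T" by (rule successive_subset[OF comb.hyps(3)]) (auto simp: G_def)
      show "\<forall>l\<in>G i. val x (T l) (r l)" using vT by (auto simp: G_def)
    qed
    from val_le_nrm[OF x this] show ?thesis using c by (simp add: pos_divide_le_eq mult_ac)
  qed simp
  have cG: "(\<Sum>i<k. card (G i)) \<le> card I"
  proof -
    have "(\<Sum>i<k. card (G i)) = card (\<Union>i<k. G i)"
      by (rule card_UN_disjoint[symmetric]) (auto simp: finG, auto simp: G_def)
    also have "\<dots> \<le> card I" by (rule card_mono[OF comb.hyps(1)]) (auto simp: G_def)
    finally show ?thesis .
  qed
  have first: "(\<Sum>i<k. \<Sum>l\<in>G i. r l) \<le> 3 * (sqrt (card I) * sqrt \<Sigma>)"
  proof -
    have "(\<Sum>i<k. \<Sum>l\<in>G i. r l) \<le> 3 * (\<Sum>i<k. sqrt (card (G i)) * nrm x (S \<inter> D i))"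
      unfolding sum_distrib_left by (rule sum_mono) (rule one)
    also have "(\<Sum>i<k. sqrt (card (G i)) * nrm x (S \<inter> D i))
        \<le> sqrt (\<Sum>i<k. (sqrt (card (G i)))\<^sup>2) * sqrt \<Sigma>"
      unfolding \<Sigma>_def by (rule sum_mult_le_sqrt)
    also have "\<dots> \<le> sqrt (card I) * sqrt \<Sigma>"
      using cG \<Sigma>0 by (intro mult_right_mono real_sqrt_le_mono) (auto simp flip: of_nat_sum)
    finally show ?thesis by simp
  qed
  have two: "card {l\<in>J. i \<in> K l} \<le> 2" for i
  proof (rule ccontr)
    assume "\<not> ?thesis"
    then have "3 \<le> card {l\<in>J. i \<in> K l}" by simp
    then obtain L where L: "L \<subseteq> {l\<in>J. i \<in> K l}" "card L = 3"
      by (meson obtain_subset_with_card_n)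
    have "finite L" using L(2) by (metis card.infinite numeral_neq_zero)
    define a where "a = Min L"
    define c where "c = Max L"
    have ac: "a \<in> L" "c \<in> L" using L(2) \<open>finite L\<close> unfolding a_def c_def by (auto intro!: Min_in Max_in)
    \<comment> \<open>A third part \<open>b\<close> strictly between \<open>a\<close> and \<open>c\<close> meets no block but \<open>D i\<close>.\<close>
    have "\<not> L \<subseteq> {a, c}" using L(2) card_mono[of "{a,c}" L] card_insert_le_m1[of 2 "{c}" a] by auto
    then obtain b where b: "b \<in> L" "b \<noteq> a" "b \<noteq> c" by blast
    have abc: "a < b" "b < c" using b \<open>finite L\<close> unfolding a_def c_def
      by (simp_all add: order_less_le)
    have in_I: "a \<in> I" "b \<in> I" "c \<in> I" using L ac b by (auto simp: J_def)
    obtain p q where p: "p \<in> T a" "p \<in> D i" and q: "q \<in> T c" "q \<in> D i" and ik: "i < k"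
    proof -
      have "i \<in> K a" "i \<in> K c" using L(1) ac by auto
      then show ?thesis using that by (auto simp: K_def)
    qed
    have "K b \<subseteq> {i}"
    proof
      fix j assume "j \<in> K b"
      then obtain s where s: "s \<in> T b" "s \<in> D j" and jk: "j < k" by (auto simp: K_def)
      have "p < s" "s < q"
        using successiveD[OF comb.hyps(3)] in_I abc p q s by blast+
      moreover have "\<not> j < i" using successiveD[OF D, of j i s p] ik jk s p calculation by auto
      moreover have "\<not> i < j"
      proof
        assume "i < j"
        then show False using successiveD[OF D, of i j q s] ik jk s q \<open>s < q\<close> by simp
      qed
      ultimately have "j = i" by linarith
      then show "j \<in> {i}" by simp
    qed
    moreover have "b \<in> J" using L b by auto
    ultimately show False unfolding J_def by blast
  qed
  have second: "(\<Sum>l\<in>J. r l) \<le> 2 * (sqrt (card I) * sqrt (2 * \<Sigma>))"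
  proof -
    define s where "s l = (\<Sum>i<k. (nrm x (T l \<inter> D i))\<^sup>2)" for l
    have s0: "0 \<le> s l" for l unfolding s_def by (rule sum_nonneg) auto
    have "(\<Sum>l\<in>J. s l) = (\<Sum>i<k. \<Sum>l\<in>J. (nrm x (T l \<inter> D i))\<^sup>2)"
      unfolding s_def by (rule sum.swap)
    also have "\<dots> \<le> (\<Sum>i<k. 2 * (nrm x (S \<inter> D i))\<^sup>2)"
    proof (rule sum_mono)
      fix i assume i: "i \<in> {..<k}"
      have "(\<Sum>l\<in>J. (nrm x (T l \<inter> D i))\<^sup>2) = (\<Sum>l\<in>{l\<in>J. i \<in> K l}. (nrm x (T l \<inter> D i))\<^sup>2)"
        using finJ i nrm_empty[OF x] by (intro sum.mono_neutral_right) (auto simp: K_def)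
      also have "\<dots> \<le> (\<Sum>l\<in>{l\<in>J. i \<in> K l}. (nrm x (S \<inter> D i))\<^sup>2)"
        using T_sub by (intro sum_mono power_mono nrm_mono x nrm_nonneg) (auto simp: J_def)
      also have "\<dots> \<le> 2 * (nrm x (S \<inter> D i))\<^sup>2"
        using two[of i] by (simp add: mult_right_mono)
      finally show "(\<Sum>l\<in>J. (nrm x (T l \<inter> D i))\<^sup>2) \<le> 2 * (nrm x (S \<inter> D i))\<^sup>2" .
    qed
    finally have sJ: "(\<Sum>l\<in>J. s l) \<le> 2 * \<Sigma>" by (simp add: \<Sigma>_def sum_distrib_left)
    have "(\<Sum>l\<in>J. r l) \<le> 2 * (\<Sum>l\<in>J. sqrt (s l))"
      unfolding sum_distrib_left
    proof (rule sum_mono)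
      fix l assume "l \<in> J"
      then have "l \<in> I" by (simp add: J_def)
      then show "r l \<le> 2 * sqrt (s l)"
        unfolding s_def by (rule IH)
    qed
    also have "(\<Sum>l\<in>J. sqrt (s l)) \<le> sqrt (card J) * sqrt (\<Sum>l\<in>J. s l)"
      using sum_le_sqrt_card[of "\<lambda>l. sqrt (s l)" J] s0 by simp
    also have "\<dots> \<le> sqrt (card I) * sqrt (2 * \<Sigma>)"
      using card_mono[OF comb.hyps(1), of J] sJ
      by (intro mult_mono real_sqrt_le_mono) (auto simp: J_def s0 sum_nonneg)
    finally show ?thesis by simp
  qed
  show ?case
  proof (cases "I = {}")
    case True
    then show ?thesis using \<Sigma>0 by (simp add: \<Sigma>_def)
  next
    case False
    then have c: "0 < sqrt (real (card I))" using comb.hyps(1) by (simp add: card_gt_0_iff)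
    \<comment> \<open>The bound \<open>\<surd>2 \<le> 3/2\<close> makes both contributions at most \<open>3 \<surd>\<bar>I\<bar> \<surd>\<Sigma>\<close>.\<close>
    have "sqrt (2 * \<Sigma>) \<le> 3/2 * sqrt \<Sigma>"
    proof -
      have "sqrt 2 \<le> sqrt ((3/2)\<^sup>2)" by (rule real_sqrt_le_mono) (simp add: power2_eq_square)
      then have "sqrt 2 \<le> 3/2" by simp
      then show ?thesis unfolding real_sqrt_mult by (rule mult_right_mono) (simp add: \<Sigma>0)
    qed
    then have "2 * (sqrt (card I) * sqrt (2 * \<Sigma>)) \<le> 2 * (sqrt (card I) * (3/2 * sqrt \<Sigma>))"
      using c by (intro mult_left_mono) auto
    then have "(\<Sum>l\<in>I. r l) \<le> 3 * (sqrt (card I) * sqrt \<Sigma>) + 3 * (sqrt (card I) * sqrt \<Sigma>)"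
      using split first second by linarith
    then have "(\<Sum>l\<in>I. r l) \<le> 2 * sqrt \<Sigma> * (3 * sqrt (card I))" by (simp add: mult_ac)
    then show ?thesis using c by (simp add: pos_divide_le_eq \<Sigma>_def)
  qed
qed

lemma upper_estimate:
  assumes "x \<in> Tz" "successive {..<k} D" "S \<subseteq> (\<Union>i<k. D i)"
  shows "nrm x S \<le> 2 * sqrt (\<Sum>i<k. (nrm x (S \<inter> D i))\<^sup>2)"
  by (rule nrm_le) (rule upper_estimate_val[OF assms(1,2) _ assms(3)])

section \<open>Reflexivity\<close>

lemma successive_intervals:
  fixes a :: "nat \<Rightarrow> nat"
  assumes "\<And>i j. i \<le> j \<Longrightarrow> a i \<le> a j"
  shows "successive I (\<lambda>i. {a i..<a (Suc i)})"
  unfolding successive_def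
proof (intro ballI impI)
  fix i j p q :: nat assume "i < j" "p \<in> {a i..<a (Suc i)}" "q \<in> {a j..<a (Suc j)}"
  then show "p < q" using assms[of "Suc i" j] by simp
qed

lemma less_nrm_finite:
  assumes x: "x \<in> Tz" and "e < nrm x {n..}" shows "\<exists>n'>n. e < nrm x {n..<n'}"
proof -
  obtain r where r: "val x {n..} r" "e < r" using less_nrm[OF assms] by blast
  obtain F where F: "finite F" "F \<subseteq> {n..}" "val x F r" using val_finite_support[OF r(1)] by blast
  define m where "m = Max F"
  have m: "F \<subseteq> {..m}" using F(1) by (auto simp: m_def)
  have "F \<subseteq> {n..<Suc (max n m)}"
  proof
    fix p assume "p \<in> F"
    then have "p \<in> {n..}" "p \<in> {..m}" using F(2) m by blast+
    then show "p \<in> {n..<Suc (max n m)}" by auto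
  qed
  then have "r \<le> nrm x {n..<Suc (max n m)}" by (intro val_le_nrm[OF x] val_mono[OF F(3)])
  then show ?thesis using r(2) by (intro exI[of _ "Suc (max n m)"]) auto
qed

text \<open>
  If the tails stayed above \<open>e\<close>, there would be infinitely many successive pieces of norm above
  \<open>e\<close>, and \<open>k\<close> of them force the norm of \<open>x\<close> to exceed \<open>e \<surd>k / 3\<close>.
\<close>

lemma tail_tendsto:
  assumes x: "x \<in> Tz" shows "(\<lambda>n. nrm x {n..}) \<longlonglongrightarrow> 0"
proof (rule ccontr)
  assume not: "\<not> ?thesis"
  have "\<exists>e>0. \<forall>n. e < nrm x {n..}"
  proof (rule ccontr)
    assume *: "\<not> ?thesis"
    have "\<exists>M. \<forall>n\<ge>M. norm (nrm x {n..} - 0) < e" if "0 < e" for e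
    proof -
      have "\<not> (\<forall>n. e/2 < nrm x {n..})" using * half_gt_zero[OF that] by blast
      then obtain M where M: "nrm x {M..} \<le> e/2" by (auto simp: not_less)
      have "norm (nrm x {n..} - 0) < e" if "M \<le> n" for n
        using M nrm_mono[OF x, of "{n..}" "{M..}"] that nrm_nonneg[OF x, of "{n..}"] \<open>0 < e\<close> by auto
      then show ?thesis by blast
    qed
    then show False using not by (simp add: LIMSEQ_iff)
  qed
  then obtain e where e: "0 < e" "\<And>n. e < nrm x {n..}" by blast
  have "\<exists>a. \<forall>i. a i < a (Suc i) \<and> e < nrm x {a i..<a (Suc i)}"
    using dependent_nat_choice[of "\<lambda>_ _. True" "\<lambda>_ n n'. n < n' \<and> e < nrm x {n..<n'}"]
      less_nrm_finite[OF x e(2)] by auto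
  then obtain a where a: "\<And>i. a i < a (Suc i)" "\<And>i. e < nrm x {a i..<a (Suc i)}" by blast
  have "e * sqrt k / 3 \<le> nrm x UNIV" for k :: nat
    using lower_estimate_const[OF x, of "{..<k}" "\<lambda>i. {a i..<a (Suc i)}" UNIV e] a
      successive_intervals[of a "{..<k}"] lift_Suc_mono_le[of a] by (simp add: less_imp_le)
  then have bd: "sqrt k \<le> 3 * nrm x UNIV / e" for k :: nat using e(1) by (simp add: field_simps)
  obtain k :: nat where "(3 * nrm x UNIV / e)\<^sup>2 < k" using reals_Archimedean2 by blast
  then have "3 * nrm x UNIV / e < sqrt k" using real_less_rsqrt by blast
  then show False using bd[of k] by simp
qed

lemma nrm_diff_cut: "nrm (x - cut {..<n} x) S = nrm x (S \<inter> {n..})"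
proof -
  have "x - cut {..<n} x = cut {n..} x" by (auto simp: fun_eq_iff)
  then show ?thesis by (simp add: nrm_cut)
qed

lemma fun_sum_apply: "(\<Sum>i\<in>I. f i) x = (\<Sum>i\<in>I. f i x)" for f :: "'i \<Rightarrow> 'a \<Rightarrow> real"
  by (induction I rule: infinite_finite_induct) auto

text \<open>
  Extended by \<open>0\<close> outside the space, as elements of the dual have to be.
\<close>

definition coord :: "nat \<Rightarrow> (nat \<Rightarrow> real) \<Rightarrow> real" where
  "coord n = (\<lambda>x. if x \<in> Tz then x n else 0)"

definition basis :: "nat \<Rightarrow> nat \<Rightarrow> real" where
  "basis n = (\<lambda>m. if m = n then 1 else 0)"

abbreviation Tz_dual :: "((nat \<Rightarrow> real) \<Rightarrow> real) set" where "Tz_dual \<equiv> dual_space Tz tz_norm"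
abbreviation Tz_dual_norm :: "((nat \<Rightarrow> real) \<Rightarrow> real) \<Rightarrow> real" where "Tz_dual_norm \<equiv> dual_norm Tz tz_norm"

interpretation Tz_dual: normed_space_on Tz_dual Tz_dual_norm by (rule Tz.dual_normed_space)

lemma tz_norm_nonneg: "x \<in> Tz \<Longrightarrow> 0 \<le> tz_norm x" by (rule Tz.norm_nonneg)

lemma coord_dual: "coord n \<in> Tz_dual"
  unfolding dual_space_def
proof (intro CollectI conjI ballI allI)
  show "\<exists>B. \<forall>x\<in>Tz. \<bar>coord n x\<bar> \<le> B * tz_norm x"
    by (rule exI[of _ 1]) (simp add: coord_def tz_norm_def abs_le_nrm)
qed (auto simp: coord_def add_Tz scale_Tz)

lemma val_vanish:
  assumes "val x S r" "\<And>n. n \<in> S \<Longrightarrow> x n = 0" shows "r = 0"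
proof -
  obtain F f where "F \<subseteq> S" "r = (\<Sum>p\<in>F. f p * \<bar>x p\<bar>)" using val_functional[OF assms(1)] by blast
  then show ?thesis using assms(2) by (auto intro!: sum.neutral)
qed

lemma val_basis_le: "val (basis n) S r \<Longrightarrow> r \<le> 1"
proof (induction rule: val.induct)
  case (unit m S) then show ?case by (simp add: basis_def)
next
  case (comb I T S r)
  have "(\<Sum>i\<in>I. r i) \<le> 1"
  proof (cases "\<exists>i\<in>I. n \<in> T i")
    case True
    then obtain i where i: "i \<in> I" "n \<in> T i" by blast
    have "r j = 0" if "j \<in> I" "j \<noteq> i" for j
    proof -
      have "n \<notin> T j"
        using successiveD[OF comb.hyps(3) i(1) that(1), of n n] i that
          successiveD[OF comb.hyps(3) that(1) i(1), of n n] by (cases "i < j") auto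
      then have "\<And>m. m \<in> T j \<Longrightarrow> basis n m = 0" by (auto simp: basis_def)
      then show ?thesis using val_vanish[of "basis n" "T j" "r j"] comb.IH that(1) by simp
    qed
    then have "(\<Sum>j\<in>I. r j) = (\<Sum>j\<in>{i}. r j)"
      using comb.hyps(1) i(1) by (intro sum.mono_neutral_right) auto
    then show ?thesis using comb.IH i(1) by simp
  next
    case False
    have "r j = 0" if "j \<in> I" for j
    proof -
      have "\<And>m. m \<in> T j \<Longrightarrow> basis n m = 0" using False that by (auto simp: basis_def)
      then show ?thesis using val_vanish[of "basis n" "T j" "r j"] comb.IH that by simp
    qed
    then show ?thesis by simp
  qed
  show ?case
  proof (cases "I = {}")
    case False
    then have "1 \<le> real (card I)" using comb.hyps(1) by (simp add: Suc_le_eq card_gt_0_iff)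
    then have "1 \<le> sqrt (card I)" by simp
    then have "1 \<le> 3 * sqrt (card I)" by linarith
    then show ?thesis using \<open>(\<Sum>i\<in>I. r i) \<le> 1\<close> by (simp add: divide_le_eq)
  qed simp
qed

lemma basis_Tz: "basis n \<in> Tz"
  by (rule Tz_I) (rule val_basis_le)

lemma cut_eq_sum: "cut {..<n} x = (\<Sum>p<n. x p *\<^sub>R basis p)"
proof
  fix m
  have "(\<Sum>p<n. x p *\<^sub>R basis p) m = (\<Sum>p<n. if p = m then x p else 0)"
    unfolding fun_sum_apply by (rule sum.cong) (auto simp: basis_def)
  then show "cut {..<n} x m = (\<Sum>p<n. x p *\<^sub>R basis p) m" by simp
qed

lemma dual_linear:
  assumes "f \<in> dual_space V N" "x \<in> V" "y \<in> V"
  shows "f (x + y) = f x + f y" "f (c *\<^sub>R x) = c * f x"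
  using assms unfolding dual_space_def by auto

lemma (in normed_space_on) dual_sum:
  assumes f: "f \<in> dual_space V N" and "\<And>i. i \<in> I \<Longrightarrow> x i \<in> V"
  shows "f (\<Sum>i\<in>I. c i *\<^sub>R x i) = (\<Sum>i\<in>I. c i * f (x i))"
  using assms(2)
proof (induction I rule: infinite_finite_induct)
  case (insert i I)
  have V: "c i *\<^sub>R x i \<in> V" "(\<Sum>i\<in>I. c i *\<^sub>R x i) \<in> V"
    using insert.prems subspace by (auto intro!: subspace_sum subspace_scale)
  show ?case using insert dual_linear(1)[OF f V] dual_linear(2)[OF f, of "x i" "x i"] by simp
next
  case (infinite I)
  have "0 \<in> V" using subspace by (rule subspace_0)
  then show ?case using infinite dual_linear(2)[OF f, of 0 0 0] by simp
next
  case empty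
  have "0 \<in> V" using subspace by (rule subspace_0)
  then show ?case using dual_linear(2)[OF f, of 0 0 0] by simp
qed

lemma (in normed_space_on) dual_diff:
  assumes f: "f \<in> dual_space V N" and "x \<in> V" "y \<in> V"
  shows "f (x - y) = f x - f y"
proof -
  have "(-1) *\<^sub>R y \<in> V" using assms(3) subspace by (intro subspace_scale)
  then have "f (x + (-1) *\<^sub>R y) = f x + (-1) * f y"
    using assms dual_linear[OF f] by metis
  then show ?thesis by simp
qed

lemma (in normed_space_on) dual_bound:
  assumes f: "f \<in> dual_space V N"
  obtains B where "0 < B" "\<And>x. x \<in> V \<Longrightarrow> \<bar>f x\<bar> \<le> B * N x"
proof -
  obtain B where B: "\<And>x. x \<in> V \<Longrightarrow> \<bar>f x\<bar> \<le> B * N x" using dual_space_bounded[OF f] by blast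
  have "\<bar>f x\<bar> \<le> (\<bar>B\<bar> + 1) * N x" if "x \<in> V" for x
    using B[OF that] norm_nonneg[OF that] by (smt (verit) mult_right_mono)
  then show ?thesis using that[of "\<bar>B\<bar> + 1"] by simp
qed

lemma dual_cut_tendsto:
  assumes f: "f \<in> Tz_dual" and x: "x \<in> Tz"
  shows "(\<lambda>n. f (cut {..<n} x)) \<longlonglongrightarrow> f x"
proof -
  obtain B where B: "0 < B" "\<And>x. x \<in> Tz \<Longrightarrow> \<bar>f x\<bar> \<le> B * tz_norm x" using Tz.dual_bound[OF f] by blast
  have "norm (f x - f (cut {..<n} x)) \<le> norm (nrm x {n..}) * B" for n
    using B(2)[OF diff_Tz[OF x cut_Tz[OF x]], of "{..<n}"] Tz.dual_diff[OF f x cut_Tz[OF x]]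
      nrm_nonneg[OF x, of "{n..}"]
    by (simp add: tz_norm_def nrm_diff_cut mult.commute)
  then have "(\<lambda>n. f x - f (cut {..<n} x)) \<longlonglongrightarrow> 0"
    by (intro tendsto_0_le[OF tail_tendsto[OF x]] always_eventually) blast
  from tendsto_diff[OF tendsto_const[of "f x"] this] show ?thesis by simp
qed

text \<open>
  Otherwise there are successive normalized blocks \<open>u\<^sub>i\<close> with \<open>f u\<^sub>i > e\<close>; then \<open>f\<close> is at least
  \<open>k e\<close> at the sum of \<open>k\<close> of them, whose norm is at most \<open>2 \<surd>k\<close> by the upper estimate.
\<close>

lemma shrinking:
  assumes f: "f \<in> Tz_dual" and e: "0 < e"
  shows "\<exists>M. \<forall>n\<ge>M. \<forall>x\<in>Tz. tz_norm x \<le> 1 \<longrightarrow> \<bar>f (x - cut {..<n} x)\<bar> \<le> e"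
proof (rule ccontr)
  assume not: "\<not> ?thesis"
  have step: "\<exists>n' u. n < n' \<and> u \<in> Tz \<and> tz_norm u \<le> 1 \<and> cut {n..<n'} u = u \<and> e < f u" for n
  proof -
    obtain m x where mx: "n \<le> m" "x \<in> Tz" "tz_norm x \<le> 1" "e < \<bar>f (x - cut {..<m} x)\<bar>"
      using not by (meson not_le)
    define y where "y = x - cut {..<m} x"
    have y: "y \<in> Tz" unfolding y_def by (intro diff_Tz mx cut_Tz)
    have Ny: "nrm y S \<le> 1" for S
      using nrm_mono[OF mx(2), of "S \<inter> {m..}" UNIV] mx(3) by (simp add: y_def nrm_diff_cut tz_norm_def)
    have "(\<lambda>k. \<bar>f (cut {..<k} y)\<bar>) \<longlonglongrightarrow> \<bar>f y\<bar>" by (intro tendsto_rabs dual_cut_tendsto f y)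
    then have "\<forall>\<^sub>F k in sequentially. e < \<bar>f (cut {..<k} y)\<bar>" using mx(4) by (intro order_tendstoD) (auto simp: y_def)
    then have "\<forall>\<^sub>F k in sequentially. e < \<bar>f (cut {..<k} y)\<bar> \<and> n < k"
      using eventually_gt_at_top[of n] by eventually_elim simp
    then obtain k where k: "e < \<bar>f (cut {..<k} y)\<bar>" "n < k" by (auto dest!: eventually_happens)
    \<comment> \<open>The sign makes the value of \<open>f\<close> positive, so that the values at different blocks add up.\<close>
    define u where "u = sgn (f (cut {..<k} y)) *\<^sub>R cut {..<k} y"
    have "f u = \<bar>f (cut {..<k} y)\<bar>"
      unfolding u_def using dual_linear(2)[OF f cut_Tz[OF y] cut_Tz[OF y]] by (simp add: sgn_mult_self_eq abs_sgn mult.commute)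
    moreover have "u \<in> Tz" unfolding u_def by (intro scale_Tz cut_Tz y)
    moreover have "tz_norm u \<le> 1"
    proof -
      have "tz_norm u = \<bar>sgn (f (cut {..<k} y))\<bar> * nrm y {..<k}"
        unfolding u_def using nrm_scale[OF cut_Tz[OF y]] by (simp add: tz_norm_def nrm_cut)
      also have "\<dots> \<le> 1" using Ny[of "{..<k}"] by (simp add: abs_sgn_eq)
      finally show ?thesis .
    qed
    moreover have "cut {n..<k} u = u"
      using mx(1) by (auto simp: u_def y_def fun_eq_iff)
    ultimately show ?thesis using k by (intro exI[of _ k] exI[of _ u]) auto
  qed
  then obtain nx w where w: "\<And>n. n < nx n \<and> w n \<in> Tz \<and> tz_norm (w n) \<le> 1 \<and> cut {n..<nx n} (w n) = w n \<and> e < f (w n)"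
    by metis
  define a where "a i = (nx ^^ i) 0" for i
  define u where "u i = w (a i)" for i
  have a: "a i < a (Suc i)" for i using w[of "a i"] by (simp add: a_def)
  have u: "u i \<in> Tz" "tz_norm (u i) \<le> 1" "cut {a i..<a (Suc i)} (u i) = u i" "e < f (u i)" for i
    using w[of "a i"] by (simp_all add: u_def a_def)
  have mono: "i \<le> j \<Longrightarrow> a i \<le> a j" for i j using lift_Suc_mono_le[of a] a by (simp add: less_imp_le)
  obtain B where B: "0 < B" "\<And>x. x \<in> Tz \<Longrightarrow> \<bar>f x\<bar> \<le> B * tz_norm x" using Tz.dual_bound[OF f] by blast
  have bd: "e * k \<le> B * (2 * sqrt k)" for k :: nat
  proof -
    define s where "s = (\<Sum>i<k. u i)"
    have s: "s \<in> Tz" unfolding s_def by (rule sum_Tz) (rule u)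
    have on: "cut {a i..<a (Suc i)} s = u i" if "i < k" for i
    proof
      fix m
      show "cut {a i..<a (Suc i)} s m = u i m"
      proof (cases "m \<in> {a i..<a (Suc i)}")
        case True
        have "u j m = 0" if "j \<noteq> i" for j
        proof -
          have "m \<notin> {a j..<a (Suc j)}"
            using True mono[of "Suc i" j] mono[of "Suc j" i] that by (cases "i < j") auto
          then show ?thesis using fun_cong[OF u(3)[of j], of m] by auto
        qed
        then have "s m = (\<Sum>j\<in>{i}. u j m)"
          unfolding s_def fun_sum_apply using that by (intro sum.mono_neutral_right) auto
        then show ?thesis using True by simp
      next
        case False
        then show ?thesis using fun_cong[OF u(3)[of i], of m] by auto
      qed
    qed
    have "tz_norm s \<le> 2 * sqrt k"
    proof -
      let ?D = "\<lambda>i. {a i..<a (Suc i)}"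
      have out: "s m = 0" if "m \<notin> (\<Union>i<k. ?D i)" for m
      proof -
        have "u i m = 0" if "i < k" for i
        proof -
          have "m \<notin> ?D i" using \<open>m \<notin> (\<Union>i<k. ?D i)\<close> that by blast
          then show ?thesis using fun_cong[OF u(3)[of i], of m] by (simp split: if_splits)
        qed
        then show ?thesis unfolding s_def fun_sum_apply by simp
      qed
      have "cut (\<Union>i<k. ?D i) s = s" using out by (auto simp: fun_eq_iff)
      then have "tz_norm s = nrm s (\<Union>i<k. ?D i)" by (metis tz_norm_cut)
      also have "\<dots> \<le> 2 * sqrt (\<Sum>i<k. (nrm s ((\<Union>i<k. ?D i) \<inter> ?D i))\<^sup>2)"
        by (intro upper_estimate s successive_intervals mono) auto
      also have "\<dots> \<le> 2 * sqrt (\<Sum>i<k. 1)"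
      proof (intro mult_left_mono real_sqrt_le_mono sum_mono)
        fix i assume "i \<in> {..<k}"
        then have "nrm s ((\<Union>i<k. ?D i) \<inter> ?D i) \<le> tz_norm (u i)"
          using on[of i, symmetric] nrm_mono[OF s] by (simp add: tz_norm_cut)
        then show "(nrm s ((\<Union>i<k. ?D i) \<inter> ?D i))\<^sup>2 \<le> 1"
          using u(2)[of i] nrm_nonneg[OF s] by (simp add: power_le_one)
      qed auto
      finally show ?thesis by simp
    qed
    moreover have "f s = (\<Sum>i<k. f (u i))" unfolding s_def
      using Tz.dual_sum[OF f, of "{..<k}" u "\<lambda>_. 1"] u(1) by simp
    moreover have "(\<Sum>i<k. e) \<le> (\<Sum>i<k. f (u i))" by (rule sum_mono) (use u(4) less_imp_le in auto)
    moreover have "\<bar>f s\<bar> \<le> B * tz_norm s" by (rule B(2)[OF s])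
    moreover have "B * tz_norm s \<le> B * (2 * sqrt k)" using B(1) calculation(1) by (intro mult_left_mono) auto
    ultimately show ?thesis by (simp add: mult.commute)
  qed
  obtain k :: nat where k: "(2 * B / e)\<^sup>2 < k" using reals_Archimedean2 by blast
  have "0 < real k" using k by (smt (verit) zero_le_power2)
  then have "e * sqrt k \<le> 2 * B"
  proof -
    have "sqrt k * (e * sqrt k) \<le> sqrt k * (2 * B)" using bd[of k] by (simp add: mult_ac)
    then show ?thesis using \<open>0 < real k\<close> by simp
  qed
  then have "sqrt k \<le> 2 * B / e" using e by (simp add: field_simps)
  moreover have "2 * B / e < sqrt k" using k real_less_rsqrt by blast
  ultimately show False by simp
qed

text \<open>
  Choosing the signs of the coefficients to match those of \<open>z\<close> turns an admissible functional into a
  linear combination of coordinate functionals in the unit ball of the dual.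
\<close>

lemma val_dual_ball:
  assumes z: "val z UNIV r"
  obtains F c where "finite F" "r = (\<Sum>p\<in>F. c p * z p)" "\<And>x. x \<in> Tz \<Longrightarrow> \<bar>\<Sum>p\<in>F. c p * x p\<bar> \<le> tz_norm x"
proof -
  obtain F f where f: "finite F" "\<And>p. 0 \<le> f p" "r = (\<Sum>p\<in>F. f p * \<bar>z p\<bar>)"
      "\<And>y. val y UNIV (\<Sum>p\<in>F. f p * \<bar>y p\<bar>)"
    using val_functional[OF z] by blast
  have eq: "r = (\<Sum>p\<in>F. (f p * sgn (z p)) * z p)"
    unfolding f(3) by (rule sum.cong) (auto simp: abs_sgn)
  have le: "\<bar>\<Sum>p\<in>F. (f p * sgn (z p)) * x p\<bar> \<le> tz_norm x" if "x \<in> Tz" for x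
  proof -
    have "\<bar>\<Sum>p\<in>F. (f p * sgn (z p)) * x p\<bar> \<le> (\<Sum>p\<in>F. \<bar>(f p * sgn (z p)) * x p\<bar>)" by (rule sum_abs)
    also have "\<dots> \<le> (\<Sum>p\<in>F. f p * \<bar>x p\<bar>)"
      using f(2) by (intro sum_mono) (auto simp: abs_mult abs_sgn_eq)
    also have "\<dots> \<le> tz_norm x" unfolding tz_norm_def by (rule val_le_nrm[OF that f(4)])
    finally show ?thesis .
  qed
  show ?thesis by (rule that[OF f(1) eq le])
qed

text \<open>
  The representing vector of \<open>\<phi>\<close> must have the coordinates \<open>z\<^sub>n = \<phi> e\<^sub>n\<^sup>*\<close>. It lies in the space because
  every functional that computes its norm lies in the unit ball of the dual. That it represents \<open>\<phi>\<close> is clear on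
  the coordinate functionals, whose span is dense by \<open>shrinking\<close>.
\<close>

lemma reflexive_Tz: "reflexive_space_on Tz tz_norm"
  unfolding reflexive_space_on_def
proof
  fix \<phi> assume \<phi>: "\<phi> \<in> dual_space Tz_dual Tz_dual_norm"
  obtain B where B: "0 < B" "\<And>f. f \<in> Tz_dual \<Longrightarrow> \<bar>\<phi> f\<bar> \<le> B * Tz_dual_norm f" using Tz_dual.dual_bound[OF \<phi>] by blast
  define z where "z n = \<phi> (coord n)" for n
  have zT: "z \<in> Tz"
  proof (rule Tz_I)
    fix r assume "val z UNIV r"
    then obtain F c where F: "finite F" "r = (\<Sum>p\<in>F. c p * z p)"
        "\<And>x. x \<in> Tz \<Longrightarrow> \<bar>\<Sum>p\<in>F. c p * x p\<bar> \<le> tz_norm x"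
      using val_dual_ball by blast
    define g where "g = (\<Sum>p\<in>F. c p *\<^sub>R coord p)"
    have g: "g \<in> Tz_dual" unfolding g_def using Tz_dual.subspace coord_dual by (intro subspace_sum subspace_scale)
    have "Tz_dual_norm g \<le> 1"
    proof (rule Tz.dual_norm_leI)
      fix x assume "x \<in> Tz" "tz_norm x \<le> 1"
      then show "\<bar>g x\<bar> \<le> 1" using F(3)[of x] by (simp add: g_def fun_sum_apply coord_def)
    qed
    then have "B * Tz_dual_norm g \<le> B" using B(1) by simp
    moreover have "\<phi> g = r" unfolding g_def F(2) z_def using coord_dual by (intro Tz_dual.dual_sum[OF \<phi>])
    ultimately show "r \<le> B" using B(2)[OF g] by linarith
  qed
  have "\<phi> f = f z" if f: "f \<in> Tz_dual" for f
  proof -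
    define g where "g n = (\<Sum>p<n. f (basis p) *\<^sub>R coord p)" for n
    have g: "g n \<in> Tz_dual" for n unfolding g_def using Tz_dual.subspace coord_dual by (intro subspace_sum subspace_scale)
    have fcut: "f (cut {..<n} x) = (\<Sum>p<n. x p * f (basis p))" for n x
      unfolding cut_eq_sum by (rule Tz.dual_sum[OF f basis_Tz])
    have gx: "g n x = f (cut {..<n} x)" if "x \<in> Tz" for n x
      using that by (simp add: fcut g_def fun_sum_apply coord_def mult.commute)
    have \<phi>g: "\<phi> (g n) = f (cut {..<n} z)" for n
      using Tz_dual.dual_sum[OF \<phi>, of "{..<n}" coord "\<lambda>p. f (basis p)"] coord_dual
      by (simp add: g_def fcut z_def mult.commute)
    have "(\<lambda>n. \<phi> (g n)) \<longlonglongrightarrow> \<phi> f"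
    proof (rule LIMSEQ_I)
      fix e :: real assume e: "0 < e"
      obtain M where M: "\<And>n x. n \<ge> M \<Longrightarrow> x \<in> Tz \<Longrightarrow> tz_norm x \<le> 1 \<Longrightarrow> \<bar>f (x - cut {..<n} x)\<bar> \<le> e / (2 * B)"
        using shrinking[OF f, of "e / (2 * B)"] e B(1) by auto
      have "norm (\<phi> (g n) - \<phi> f) < e" if n: "n \<ge> M" for n
      proof -
        have "Tz_dual_norm (g n - f) \<le> e / (2 * B)"
        proof (rule Tz.dual_norm_leI)
          fix x assume x: "x \<in> Tz" "tz_norm x \<le> 1"
          show "\<bar>(g n - f) x\<bar> \<le> e / (2 * B)"
            using M[OF n x] gx[OF x(1)] Tz.dual_diff[OF f x(1) cut_Tz[OF x(1)]] by (simp add: abs_minus_commute)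
        qed
        then have "B * Tz_dual_norm (g n - f) \<le> e / 2" using B(1) by (simp add: field_simps)
        moreover have "g n - f \<in> Tz_dual" using Tz_dual.subspace g f by (intro subspace_diff)
        ultimately have "\<bar>\<phi> (g n - f)\<bar> \<le> e / 2" using B(2) order_trans by blast
        then show ?thesis using Tz_dual.dual_diff[OF \<phi> g f] e by simp
      qed
      then show "\<exists>M. \<forall>n\<ge>M. norm (\<phi> (g n) - \<phi> f) < e" by blast
    qed
    moreover have "(\<lambda>n. \<phi> (g n)) \<longlonglongrightarrow> f z" unfolding \<phi>g by (rule dual_cut_tendsto[OF f zT])
    ultimately show ?thesis by (rule LIMSEQ_unique)
  qed
  then show "\<exists>x\<in>Tz. \<forall>f\<in>Tz_dual. \<phi> f = f x" using zT by blast
qed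

section \<open>Iterated limits of normalized weakly null sequences\<close>

lemma ultrafilter_nat_cases:
  fixes U :: "nat filter"
  assumes "ultrafilter U"
  obtains k where "eventually (\<lambda>n. n = k) U" | "U \<le> sequentially"
proof (cases "\<exists>k. eventually (\<lambda>n. n = k) U")
  case True then show ?thesis using that by blast
next
  case False
  then have "eventually (\<lambda>n. n \<noteq> k) U" for k using assms unfolding ultrafilter_def by blast
  then have "eventually (\<lambda>n. \<forall>k\<in>{..<N}. n \<noteq> k) U" for N by (intro eventually_ball_finite) auto
  moreover have "(\<forall>k\<in>{..<N}. n \<noteq> k) \<longleftrightarrow> N \<le> n" for n N :: nat by (auto simp: not_less)
  ultimately have "U \<le> sequentially" unfolding le_sequentially by simp
  then show ?thesis using that by blast
qed

text \<open>
  Limits of bounded functions along ultrafilters exist, so \<open>Lim\<close> is not an arbitrary value here.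
\<close>

lemma ultrafilter_Lim_between:
  fixes g :: "'b \<Rightarrow> real"
  assumes U: "ultrafilter U" and ab: "eventually (\<lambda>n. a \<le> g n \<and> g n \<le> b) U"
  shows "a \<le> Lim U g \<and> Lim U g \<le> b"
proof -
  have nb: "U \<noteq> bot" using U by (simp add: ultrafilter_def)
  define A where "A = {t. eventually (\<lambda>n. t \<le> g n) U}"
  define L where "L = Sup A"
  have aA: "a \<in> A" unfolding A_def using ab by (auto elim: eventually_mono)
  have bA: "t \<le> b" if "t \<in> A" for t
  proof -
    have "eventually (\<lambda>n. t \<le> b) U"
      using ab that unfolding A_def mem_Collect_eq by eventually_elim simp
    then show ?thesis using nb by simp
  qed
  have bdd: "bdd_above A" by (rule bdd_aboveI) (rule bA)
  have "(g \<longlongrightarrow> L) U"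
  proof (rule order_tendstoI)
    fix t assume "t < L"
    then obtain s where "s \<in> A" "t < s" using less_cSup_iff[OF _ bdd] aA unfolding L_def by blast
    then show "eventually (\<lambda>n. t < g n) U" unfolding A_def by (auto elim: eventually_mono)
  next
    fix t assume t: "L < t"
    have "t \<notin> A"
    proof
      assume "t \<in> A"
      then have "t \<le> L" unfolding L_def by (rule cSup_upper[OF _ bdd])
      then show False using t by simp
    qed
    then have "eventually (\<lambda>n. \<not> t \<le> g n) U" using U unfolding A_def ultrafilter_def by blast
    then show "eventually (\<lambda>n. g n < t) U" by (simp add: not_le)
  qed
  then have "Lim U g = L" by (rule tendsto_Lim[OF nb])
  moreover have "a \<le> L" unfolding L_def by (rule cSup_upper[OF aA bdd])
  moreover have "L \<le> b" unfolding L_def by (rule cSup_least) (use aA bA in auto)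
  ultimately show ?thesis by simp
qed

text \<open>
  An iterated limit is controlled by an invariant of the partial assignments. The invariant has to
  survive only for almost all values of the variable that is bound next, which is where everything known about
  the sequences enters.
\<close>

lemma iterated_Lim_between:
  assumes "\<And>i. i \<in> set is \<Longrightarrow> ultrafilter (U i)"
    and "P is \<nu>"
    and "\<And>i is \<nu>. P (i # is) \<nu> \<Longrightarrow> eventually (\<lambda>n. P is (\<nu>(i := n))) (U i)"
    and "\<And>\<nu>. P [] \<nu> \<Longrightarrow> a \<le> F \<nu> \<and> F \<nu> \<le> b"
  shows "a \<le> iterated_Lim U F is \<nu> \<and> iterated_Lim U F is \<nu> \<le> b"
  using assms(1,2)
proof (induction "is" arbitrary: \<nu>)
  case Nil then show ?case using assms(4) by simp
next
  case (Cons i "is")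
  have "eventually (\<lambda>n. P is (\<nu>(i := n))) (U i)" by (rule assms(3)[OF Cons.prems(2)])
  then have "eventually (\<lambda>n. a \<le> iterated_Lim U F is (\<nu>(i := n)) \<and> iterated_Lim U F is (\<nu>(i := n)) \<le> b) (U i)"
    by (rule eventually_mono) (use Cons in simp)
  then show ?case using ultrafilter_Lim_between[OF Cons.prems(1)] by simp
qed

lemma tz_norm_basis_le: "tz_norm (basis n) \<le> 1"
  unfolding tz_norm_def by (rule nrm_le) (rule val_basis_le)

lemma nrm_le_sum:
  assumes "x \<in> Tz" shows "nrm x {..<R} \<le> (\<Sum>p<R. \<bar>x p\<bar>)"
proof (induction R)
  case 0 then show ?case using nrm_empty[OF assms] by simp
next
  case (Suc R)
  have eq: "cut {..<Suc R} x = cut {..<R} x + x R *\<^sub>R basis R"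
    by (auto simp: fun_eq_iff basis_def less_Suc_eq)
  have "tz_norm (cut {..<Suc R} x) \<le> tz_norm (cut {..<R} x) + \<bar>x R\<bar> * tz_norm (basis R)"
    unfolding eq using Tz.norm_triangle[of "cut {..<R} x" "x R *\<^sub>R basis R"]
    by (simp add: cut_Tz assms scale_Tz basis_Tz Tz.norm_scaleR)
  also have "\<dots> \<le> tz_norm (cut {..<R} x) + \<bar>x R\<bar>"
    using mult_left_mono[OF tz_norm_basis_le[of R], of "\<bar>x R\<bar>"] by simp
  finally show ?case using Suc by (simp add: tz_norm_cut)
qed

text \<open>
  A sum of \<open>j + 1\<close> blocks cut at the points \<open>a\<close>: the initial one approximates the fixed vector \<open>y\<close>, the other
  \<open>j\<close> are normalized up to a factor \<open>2\<close>. The lower bound \<open>1/2\<close> leaves room for cutting both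
  ends off a normalized vector.
\<close>

definition block_sum :: "(nat \<Rightarrow> real) \<Rightarrow> real \<Rightarrow> nat \<Rightarrow> (nat \<Rightarrow> nat) \<Rightarrow> (nat \<Rightarrow> real) \<Rightarrow> bool" where
  "block_sum y \<epsilon> j a z \<longleftrightarrow> z \<in> Tz \<and> a 0 = 0 \<and> (\<forall>i. a i \<le> a (Suc i)) \<and> cut {..<a (Suc j)} z = z \<and>
     tz_norm y - \<epsilon> \<le> nrm z {..<a 1} \<and> nrm z {..<a 1} \<le> tz_norm y \<and>
     (\<forall>i\<in>{1..j}. 1/2 \<le> nrm z {a i..<a (Suc i)} \<and> nrm z {a i..<a (Suc i)} \<le> 1)"

lemma block_sum_start:
  assumes y: "y \<in> Tz" and e: "0 < \<epsilon>"
  shows "\<exists>a z. block_sum y \<epsilon> 0 a z \<and> tz_norm (y - z) \<le> \<epsilon>"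
proof -
  have "eventually (\<lambda>n. nrm y {n..} < \<epsilon>) sequentially"
    using tail_tendsto[OF y] e by (rule order_tendstoD)
  then obtain R where R: "nrm y {R..} < \<epsilon>" by (auto dest!: eventually_happens)
  define z where "z = cut {..<R} y"
  have "tz_norm (y - z) = nrm y {R..}" by (simp add: z_def tz_norm_def nrm_diff_cut)
  moreover have zT: "z \<in> Tz" unfolding z_def by (rule cut_Tz[OF y])
  moreover have "tz_norm y \<le> tz_norm z + tz_norm (y - z)"
    using Tz.norm_triangle[OF zT diff_Tz[OF y zT]] by simp
  moreover have "nrm z {..<R} = tz_norm z" by (simp add: z_def tz_norm_def nrm_cut)
  moreover have "tz_norm z \<le> tz_norm y" by (simp add: z_def tz_norm_def nrm_cut nrm_mono[OF y])
  moreover have "cut {..<R} z = z" by (auto simp: z_def fun_eq_iff)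
  ultimately show ?thesis using R
    by (intro exI[of _ "\<lambda>i. if i = 0 then 0 else R"] exI[of _ z]) (auto simp: block_sum_def)
qed

text \<open>
  A normalized vector that is small on the blocks already present is, up to an error, one further
  block: cut off its beginning and its tail.
\<close>

lemma block_sum_extend:
  assumes z: "block_sum y \<epsilon> j a z" and x: "x \<in> Tz" "tz_norm x = 1" and e: "0 < \<epsilon>" "\<epsilon> \<le> 1/4"
    and small: "nrm x {..<a (Suc j)} \<le> \<epsilon>"
  shows "\<exists>a' w. w \<in> Tz \<and> block_sum y \<epsilon> (Suc j) a' (z + w) \<and> tz_norm (x - w) \<le> 2 * \<epsilon>"
proof -
  define R where "R = a (Suc j)"
  have "eventually (\<lambda>n. nrm x {n..} < \<epsilon> \<and> R \<le> n) sequentially"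
    by (intro eventually_conj order_tendstoD(2)[OF tail_tendsto[OF x(1)] e(1)] eventually_ge_at_top)
  then obtain R' where R': "nrm x {R'..} < \<epsilon>" "R \<le> R'" by (auto dest!: eventually_happens)
  define w where "w = cut {R..<R'} x"
  have wT: "w \<in> Tz" unfolding w_def by (rule cut_Tz[OF x(1)])
  have "x - w = cut {..<R} x + cut {R'..} x" using R'(2) by (auto simp: w_def fun_eq_iff)
  then have "tz_norm (x - w) \<le> nrm x {..<R} + nrm x {R'..}"
    using Tz.norm_triangle[OF cut_Tz[OF x(1)] cut_Tz[OF x(1)], of "{..<R}" "{R'..}"] by (simp add: tz_norm_cut)
  then have xw: "tz_norm (x - w) \<le> 2 * \<epsilon>" using small R'(1) by (simp add: R_def)
  have "tz_norm x \<le> tz_norm w + tz_norm (x - w)"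
    using Tz.norm_triangle[OF wT diff_Tz[OF x(1) wT]] by simp
  then have w1: "1/2 \<le> nrm x {R..<R'}" using xw e x(2) by (simp add: w_def tz_norm_cut)
  have w2: "nrm x {R..<R'} \<le> 1" using nrm_mono[OF x(1), of "{R..<R'}" UNIV] x(2) by (simp add: tz_norm_def)
  define a' where "a' i = (if i \<le> Suc j then a i else R')" for i
  have z': "z \<in> Tz" "a 0 = 0" "\<And>i. a i \<le> a (Suc i)" "cut {..<R} z = z"
    "tz_norm y - \<epsilon> \<le> nrm z {..<a 1}" "nrm z {..<a 1} \<le> tz_norm y"
    "\<And>i. i \<in> {1..j} \<Longrightarrow> 1/2 \<le> nrm z {a i..<a (Suc i)} \<and> nrm z {a i..<a (Suc i)} \<le> 1"
    using z by (auto simp: block_sum_def R_def)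
  have amono: "i \<le> k \<Longrightarrow> a i \<le> a k" for i k using lift_Suc_mono_le[of a] z'(3) by blast
  have zT: "z + w \<in> Tz" by (intro add_Tz z'(1) wT)
  have z0: "z n = 0" if "R \<le> n" for n using fun_cong[OF z'(4), of n] that by simp
  have old: "nrm (z + w) S = nrm z S" if "S \<subseteq> {..<R}" for S
  proof -
    have "cut S (z + w) = cut S z" using that by (auto simp: fun_eq_iff w_def)
    then show ?thesis by (metis tz_norm_cut)
  qed
  have new: "nrm (z + w) {R..<R'} = nrm x {R..<R'}"
  proof -
    have "cut {R..<R'} (z + w) = cut {R..<R'} x" by (auto simp: fun_eq_iff w_def z0)
    then show ?thesis by (metis tz_norm_cut)
  qed
  have "block_sum y \<epsilon> (Suc j) a' (z + w)"
    unfolding block_sum_def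
  proof (intro conjI ballI allI)
    show "z + w \<in> Tz" by (rule zT)
    show "a' 0 = 0" by (simp add: a'_def z'(2))
    show "a' i \<le> a' (Suc i)" for i
      using z'(3)[of i] R'(2) unfolding R_def a'_def by (cases "i = Suc j") auto
    show "cut {..<a' (Suc (Suc j))} (z + w) = z + w"
      using R'(2) by (auto simp: fun_eq_iff a'_def w_def z0)
    have a1: "a' 1 = a 1" "{..<a 1} \<subseteq> {..<R}" using amono[of 1 "Suc j"] by (auto simp: a'_def R_def)
    show "tz_norm y - \<epsilon> \<le> nrm (z + w) {..<a' 1}" "nrm (z + w) {..<a' 1} \<le> tz_norm y"
      unfolding a1(1) old[OF a1(2)] by (fact z'(5), fact z'(6))
    fix i assume i: "i \<in> {1..Suc j}"
    have "1/2 \<le> nrm (z + w) {a' i..<a' (Suc i)} \<and> nrm (z + w) {a' i..<a' (Suc i)} \<le> 1"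
    proof (cases "i = Suc j")
      case True
      then show ?thesis using new w1 w2 by (simp add: a'_def R_def)
    next
      case False
      then have "i \<in> {1..j}" using i by auto
      moreover have "{a i..<a (Suc i)} \<subseteq> {..<R}" using amono[of "Suc i" "Suc j"] calculation by (auto simp: R_def)
      moreover have "a' i = a i" "a' (Suc i) = a (Suc i)" using calculation(1) by (auto simp: a'_def)
      ultimately show ?thesis using old[of "{a i..<a (Suc i)}"] z'(7)[of i] by simp
    qed
    then show "1/2 \<le> nrm (z + w) {a' i..<a' (Suc i)}" "nrm (z + w) {a' i..<a' (Suc i)} \<le> 1" by auto
  qed
  then show ?thesis using wT xw by blast
qed

lemma block_sum_bounds:
  assumes y: "y \<in> Tz" and z: "block_sum y \<epsilon> j a z"
  shows "tz_norm z \<le> 2 * (tz_norm y + sqrt j)" "tz_norm y - \<epsilon> \<le> tz_norm z" "sqrt j / 6 \<le> tz_norm z"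
proof -
  have z': "z \<in> Tz" "a 0 = 0" "\<And>i. a i \<le> a (Suc i)" "cut {..<a (Suc j)} z = z"
    "tz_norm y - \<epsilon> \<le> nrm z {..<a 1}" "nrm z {..<a 1} \<le> tz_norm y"
    "\<And>i. i \<in> {1..j} \<Longrightarrow> 1/2 \<le> nrm z {a i..<a (Suc i)} \<and> nrm z {a i..<a (Suc i)} \<le> 1"
    using z by (auto simp: block_sum_def)
  have amono: "i \<le> k \<Longrightarrow> a i \<le> a k" for i k using lift_Suc_mono_le[of a] z'(3) by blast
  have succ: "successive I (\<lambda>i. {a i..<a (Suc i)})" for I by (rule successive_intervals) (rule amono)
  show "tz_norm y - \<epsilon> \<le> tz_norm z"
    using z'(5) nrm_mono[OF z'(1), of "{..<a 1}" UNIV] by (simp add: tz_norm_def)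
  show "sqrt j / 6 \<le> tz_norm z"
    using lower_estimate_const[OF z'(1) _ _ succ, of "{1..j}" UNIV "1/2"] z'(7) by (simp add: tz_norm_def)
  let ?D = "\<lambda>i. {a i..<a (Suc i)}"
  have cover: "{..<a k} \<subseteq> (\<Union>i<k. ?D i)" for k
  proof (induction k)
    case 0 then show ?case by (simp add: z'(2))
  next
    case (Suc k)
    have "{..<a (Suc k)} \<subseteq> {..<a k} \<union> ?D k" by auto
    also have "\<dots> \<subseteq> (\<Union>i<Suc k. ?D i)" using Suc by (auto simp: lessThan_Suc)
    finally show ?case .
  qed
  have "tz_norm z = nrm z {..<a (Suc j)}" by (metis z'(4) tz_norm_cut)
  also have "\<dots> \<le> 2 * sqrt (\<Sum>i<Suc j. (nrm z ({..<a (Suc j)} \<inter> ?D i))\<^sup>2)"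
    by (rule upper_estimate[OF z'(1) succ cover])
  also have "(\<Sum>i<Suc j. (nrm z ({..<a (Suc j)} \<inter> ?D i))\<^sup>2) \<le> (\<Sum>i<Suc j. if i = 0 then (tz_norm y)\<^sup>2 else 1)"
  proof (rule sum_mono)
    fix i assume i: "i \<in> {..<Suc j}"
    have le: "nrm z ({..<a (Suc j)} \<inter> ?D i) \<le> nrm z (?D i)" by (rule nrm_mono[OF z'(1)]) auto
    show "(nrm z ({..<a (Suc j)} \<inter> ?D i))\<^sup>2 \<le> (if i = 0 then (tz_norm y)\<^sup>2 else 1)"
    proof (cases "i = 0")
      case True
      then have "?D i = {..<a 1}" using z'(2) by auto
      then have "nrm z ({..<a (Suc j)} \<inter> ?D i) \<le> tz_norm y" using le z'(6) by simp
      then show ?thesis using True nrm_nonneg[OF z'(1)] by (simp add: power_mono)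
    next
      case False
      then have "nrm z ({..<a (Suc j)} \<inter> ?D i) \<le> 1" using le z'(7)[of i] i by simp
      then show ?thesis using False nrm_nonneg[OF z'(1)] by (simp add: power_le_one)
    qed
  qed
  also have "(\<Sum>i<Suc j. if i = 0 then (tz_norm y)\<^sup>2 else 1) = (tz_norm y)\<^sup>2 + j"
    by (simp add: sum.lessThan_Suc_shift del: sum.lessThan_Suc)
  also have "sqrt ((tz_norm y)\<^sup>2 + j) \<le> sqrt ((tz_norm y)\<^sup>2) + sqrt j" by (rule sqrt_add_le_add_sqrt) auto
  also have "sqrt ((tz_norm y)\<^sup>2) = tz_norm y" using tz_norm_nonneg[OF y] by simp
  finally show "tz_norm z \<le> 2 * (tz_norm y + sqrt j)" by simp
qed

text \<open>
  The indices in \<open>A\<close> carry normalized sequences that vanish coordinatewise in the limit, the others sequences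
  that are eventually constant. The invariant of the iterated limit is that the sum of the vectors
  chosen so far, together with all the eventual constants, is a block sum up to an error that grows by
  \<open>2 \<epsilon>\<close> with each block. Counting the constants from the beginning makes it irrelevant where in the
  order of the variables they are bound.
\<close>

lemma iterated_norm_estimate_eps:
  fixes \<mu> :: "nat \<Rightarrow> nat" and c :: "nat \<Rightarrow> nat \<Rightarrow> real"
  assumes A: "A \<subseteq> {1..m}"
    and U: "\<forall>i\<in>{1..m}. ultrafilter (U i)"
    and c: "\<forall>i\<in>{1..m} - A. c i \<in> Tz \<and> eventually (\<lambda>n. x i n = c i) (U i)"
    and x: "\<forall>i\<in>A. \<forall>n. x i n \<in> Tz \<and> tz_norm (x i n) = 1"
    and null: "\<forall>i\<in>A. \<forall>p. ((\<lambda>n. x i n p) \<longlongrightarrow> 0) (U i)"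
    and is0: "distinct is0" "set is0 = {1..m}"
    and e: "0 < \<epsilon>" "\<epsilon> \<le> 1/4"
  defines "y \<equiv> \<Sum>i\<in>{1..m} - A. c i"
  defines "L \<equiv> iterated_Lim U (\<lambda>\<nu>. tz_norm (\<Sum>i=1..m. x i (\<nu> i))) is0 \<mu>"
  defines "\<delta> \<equiv> (2 * real (card A) + 1) * \<epsilon>"
  shows "L \<le> 2 * (tz_norm y + sqrt (card A)) + \<delta>" "tz_norm y - \<epsilon> - \<delta> \<le> L" "sqrt (card A) / 6 - \<delta> \<le> L"
proof -
  have y: "y \<in> Tz" unfolding y_def using c by (intro sum_Tz) auto
  have finA: "finite A" using A finite_subset by blast
  define v where "v is \<nu> = y + (\<Sum>i\<in>A - set is. x i (\<nu> i))" for "is" and \<nu> :: "nat \<Rightarrow> nat"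
  define P where "P is \<nu> \<longleftrightarrow> distinct is \<and> set is \<subseteq> {1..m} \<and>
      (\<forall>i\<in>{1..m} - A - set is. x i (\<nu> i) = c i) \<and>
      (\<exists>a z. block_sum y \<epsilon> (card (A - set is)) a z \<and>
         tz_norm (v is \<nu> - z) \<le> (2 * real (card (A - set is)) + 1) * \<epsilon>)" for "is" \<nu>
  have vT: "v is \<nu> \<in> Tz" for "is" \<nu>
    unfolding v_def using x by (intro add_Tz y sum_Tz) auto
  \<comment> \<open>Before any variable is bound, \<open>v\<close> is \<open>y\<close> and the block sum has just its initial block.\<close>
  have start: "P is0 \<mu>"
  proof -
    have *: "A - set is0 = {}" "{1..m} - A - set is0 = {}" using is0(2) A by auto
    show ?thesis unfolding P_def v_def * using block_sum_start[OF y e(1)] is0 by simp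
  qed
  have step: "eventually (\<lambda>n. P is (\<nu>(i := n))) (U i)" if P: "P (i # is) \<nu>" for i "is" \<nu>
  proof -
    have i: "i \<notin> set is" "i \<in> {1..m}" "distinct is" "set is \<subseteq> {1..m}" using P by (auto simp: P_def)
    have cs: "x k (\<nu> k) = c k" if "k \<in> {1..m} - A - set is" "k \<noteq> i" for k
      using P that by (simp add: P_def)
    obtain a z where z: "block_sum y \<epsilon> (card (A - set (i # is))) a z"
        "tz_norm (v (i # is) \<nu> - z) \<le> (2 * real (card (A - set (i # is))) + 1) * \<epsilon>"
      using P unfolding P_def by blast
    show ?thesis
    proof (cases "i \<in> A")
      case False
      then have eq: "A - set is = A - set (i # is)" by auto
      have "v is (\<nu>(i := n)) = v (i # is) \<nu>" for n
        unfolding v_def eq by (rule arg_cong[of _ _ "\<lambda>t. y + t"], rule sum.cong) auto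
      then have "P is (\<nu>(i := n))" if "x i n = c i" for n
        using z i cs that unfolding P_def eq by auto
      moreover have "eventually (\<lambda>n. x i n = c i) (U i)" using c False i(2) by simp
      ultimately show ?thesis by (rule eventually_mono[rotated])
    next
      case True
      define j where "j = card (A - set (i # is))"
      have eq: "A - set is = insert i (A - set (i # is))" "i \<notin> A - set (i # is)" using True i(1) by auto
      have card: "card (A - set is) = Suc j"
        unfolding j_def eq(1) using eq(2) finA by (simp add: card_insert_if)
      have v: "v is (\<nu>(i := n)) = v (i # is) \<nu> + x i n" for n
      proof -
        have "(\<Sum>k\<in>A - set is. x k ((\<nu>(i := n)) k)) = x i n + (\<Sum>k\<in>A - set (i # is). x k ((\<nu>(i := n)) k))"
          unfolding eq(1) using finA eq(2) by simp
        also have "(\<Sum>k\<in>A - set (i # is). x k ((\<nu>(i := n)) k)) = (\<Sum>k\<in>A - set (i # is). x k (\<nu> k))"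
          by (rule sum.cong) auto
        finally have s: "(\<Sum>k\<in>A - set is. x k ((\<nu>(i := n)) k)) = x i n + (\<Sum>k\<in>A - set (i # is). x k (\<nu> k))" .
        show ?thesis unfolding v_def s by (simp only: add_ac)
      qed
      let ?R = "a (Suc j)"
      have "((\<lambda>n. \<Sum>p<?R. \<bar>x i n p\<bar>) \<longlongrightarrow> (\<Sum>p<?R. \<bar>0\<bar>)) (U i)"
        by (intro tendsto_sum tendsto_rabs) (use null True in blast)
      then have "eventually (\<lambda>n. (\<Sum>p<?R. \<bar>x i n p\<bar>) < \<epsilon>) (U i)"
        using e(1) by (intro order_tendstoD(2)) auto
      then show ?thesis
      proof (rule eventually_mono)
        fix n assume n: "(\<Sum>p<?R. \<bar>x i n p\<bar>) < \<epsilon>"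
        have xi: "x i n \<in> Tz" "tz_norm (x i n) = 1" using x True by auto
        have "nrm (x i n) {..<?R} \<le> \<epsilon>" using nrm_le_sum[OF xi(1), of ?R] n by simp
        then obtain a' w where w: "w \<in> Tz" "block_sum y \<epsilon> (Suc j) a' (z + w)" "tz_norm (x i n - w) \<le> 2 * \<epsilon>"
          using block_sum_extend[OF z(1)[folded j_def] xi e] by blast
        have zT: "z \<in> Tz" using z(1) by (simp add: block_sum_def)
        have decomp: "v is (\<nu>(i := n)) - (z + w) = (v (i # is) \<nu> - z) + (x i n - w)"
          unfolding v by (simp add: fun_eq_iff)
        have "tz_norm (v is (\<nu>(i := n)) - (z + w)) \<le> tz_norm (v (i # is) \<nu> - z) + tz_norm (x i n - w)"
          unfolding decomp by (rule Tz.norm_triangle[OF diff_Tz[OF vT zT] diff_Tz[OF xi(1) w(1)]])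
        also have "\<dots> \<le> (2 * real (Suc j) + 1) * \<epsilon>"
          using z(2) w(3) unfolding j_def[symmetric] by (simp add: algebra_simps)
        finally have "tz_norm (v is (\<nu>(i := n)) - (z + w)) \<le> (2 * real (Suc j) + 1) * \<epsilon>" .
        moreover have "\<forall>k\<in>{1..m} - A - set is. x k ((\<nu>(i := n)) k) = c k" using cs True by auto
        ultimately show "P is (\<nu>(i := n))" using w(2) i(3,4) unfolding P_def card by blast
      qed
    qed
  qed
  have final: "max (tz_norm y - \<epsilon> - \<delta>) (sqrt (card A) / 6 - \<delta>) \<le> tz_norm (\<Sum>i=1..m. x i (\<nu> i)) \<and>
      tz_norm (\<Sum>i=1..m. x i (\<nu> i)) \<le> 2 * (tz_norm y + sqrt (card A)) + \<delta>" if P: "P [] \<nu>" for \<nu>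
  proof -
    obtain a z where z: "block_sum y \<epsilon> (card A) a z" "tz_norm (v [] \<nu> - z) \<le> \<delta>"
      using P unfolding P_def \<delta>_def by auto
    have zT: "z \<in> Tz" using z(1) by (simp add: block_sum_def)
    have "(\<Sum>i=1..m. x i (\<nu> i)) = (\<Sum>i\<in>{1..m} - A. x i (\<nu> i)) + (\<Sum>i\<in>A. x i (\<nu> i))"
      by (rule sum.subset_diff[OF A]) simp
    also have "(\<Sum>i\<in>{1..m} - A. x i (\<nu> i)) = y"
      unfolding y_def by (rule sum.cong) (use P in \<open>auto simp: P_def\<close>)
    finally have eq: "(\<Sum>i=1..m. x i (\<nu> i)) = v [] \<nu>" by (simp only: v_def list.set Diff_empty)
    have "tz_norm (v [] \<nu>) \<le> tz_norm z + tz_norm (v [] \<nu> - z)"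
      using Tz.norm_triangle[OF zT diff_Tz[OF vT zT]] by simp
    moreover have "tz_norm z \<le> tz_norm (v [] \<nu>) + tz_norm (v [] \<nu> - z)"
    proof -
      have "tz_norm ((-1) *\<^sub>R (v [] \<nu> - z)) = tz_norm (v [] \<nu> - z)"
        using Tz.norm_scaleR[OF diff_Tz[OF vT zT], of "-1"] by simp
      moreover have "v [] \<nu> + (-1) *\<^sub>R (v [] \<nu> - z) = z" by (simp add: fun_eq_iff)
      ultimately show ?thesis
        using Tz.norm_triangle[OF vT scale_Tz[OF diff_Tz[OF vT zT]], of "[]" \<nu> "-1" "[]" \<nu>] by simp
    qed
    ultimately show ?thesis unfolding eq using block_sum_bounds[OF y z(1)] z(2) by auto
  qed
  have "max (tz_norm y - \<epsilon> - \<delta>) (sqrt (card A) / 6 - \<delta>) \<le> L \<and> L \<le> 2 * (tz_norm y + sqrt (card A)) + \<delta>"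
    unfolding L_def by (rule iterated_Lim_between[where P = P]) (use U is0 start step final in auto)
  then show "L \<le> 2 * (tz_norm y + sqrt (card A)) + \<delta>" "tz_norm y - \<epsilon> - \<delta> \<le> L" "sqrt (card A) / 6 - \<delta> \<le> L"
    by auto
qed

lemma le_of_small_error:
  fixes a b K :: real
  assumes "\<And>\<epsilon>. 0 < \<epsilon> \<Longrightarrow> \<epsilon> \<le> 1/4 \<Longrightarrow> a \<le> b + K * \<epsilon>" "0 < K"
  shows "a \<le> b"
proof (rule field_le_epsilon)
  fix d :: real assume d: "0 < d"
  have "a \<le> b + K * min (1/4) (d / K)" using assms(2) d min.cobounded1[of "1/4" "d / K"] by (intro assms(1)) simp_all
  also have "\<dots> \<le> b + K * (d / K)" using assms(2) by (intro add_left_mono mult_left_mono) auto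
  finally show "a \<le> b + d" using assms(2) by simp
qed

text \<open>
  The bounds do not mention \<open>\<sigma>\<close>; letting the error tend to \<open>0\<close> leaves an order of magnitude that is common
  to all orders of the variables.
\<close>

lemma iterated_norm_estimate:
  assumes A: "A \<subseteq> {1..m}"
    and U: "\<forall>i\<in>{1..m}. ultrafilter (U i)"
    and c: "\<forall>i\<in>{1..m} - A. c i \<in> Tz \<and> eventually (\<lambda>n. x i n = c i) (U i)"
    and x: "\<forall>i\<in>A. \<forall>n. x i n \<in> Tz \<and> tz_norm (x i n) = 1"
    and null: "\<forall>i\<in>A. \<forall>p. ((\<lambda>n. x i n p) \<longlongrightarrow> 0) (U i)"
    and \<sigma>: "\<sigma> permutes {1..m}"
  defines "y \<equiv> \<Sum>i\<in>{1..m} - A. c i"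
  shows "iterated_norm_Lim tz_norm m \<sigma> x U \<le> 2 * (tz_norm y + sqrt (card A))"
    "tz_norm y \<le> iterated_norm_Lim tz_norm m \<sigma> x U" "sqrt (card A) / 6 \<le> iterated_norm_Lim tz_norm m \<sigma> x U"
proof -
  let ?L = "iterated_norm_Lim tz_norm m \<sigma> x U"
  have d: "distinct (map \<sigma> [1..<Suc m])" "set (map \<sigma> [1..<Suc m]) = {1..m}"
    using permutes_inj_on[OF \<sigma>] permutes_image[OF \<sigma>]
    by (simp_all add: distinct_map atLeastLessThanSuc_atLeastAtMost del: upt_Suc)
  note est = iterated_norm_estimate_eps[OF A U c x null d, where \<mu> = "\<lambda>_. 0",
      folded iterated_norm_Lim_def y_def]
  show "?L \<le> 2 * (tz_norm y + sqrt (card A))"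
    by (rule le_of_small_error[of _ _ "2 * real (card A) + 1"]) (use est(1) in auto)
  show "tz_norm y \<le> ?L"
    by (rule le_of_small_error[of _ _ "2 * real (card A) + 2"]) (use est(2) in \<open>auto simp: algebra_simps\<close>)
  show "sqrt (card A) / 6 \<le> ?L"
    by (rule le_of_small_error[of _ _ "2 * real (card A) + 1"]) (use est(3) in \<open>auto simp: algebra_simps\<close>)
qed

text \<open>
  The constant arises as \<open>\<parallel>y\<parallel> \<le> L\<close> and \<open>\<surd>k \<le> 6 L\<close>, whence \<open>2 (\<parallel>y\<parallel> + \<surd>k) \<le> 14 L\<close>.
\<close>

lemma normalized_weakly_null_symmetric:
  assumes \<sigma>: "\<sigma> permutes {1..m}"
    and x: "\<forall>i\<in>{1..m}. normalized_seq_on Tz tz_norm (x i) \<and> weakly_null_on Tz tz_norm (x i)"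
    and U: "\<forall>i\<in>{1..m}. ultrafilter (U i)"
  shows "iterated_norm_Lim tz_norm m id x U \<le> 14 * iterated_norm_Lim tz_norm m \<sigma> x U"
proof -
  define A where "A = {i\<in>{1..m}. U i \<le> sequentially}"
  have "\<exists>k. eventually (\<lambda>n. n = k) (U i)" if "i \<in> {1..m} - A" for i
  proof -
    have "ultrafilter (U i)" "\<not> U i \<le> sequentially" using that U by (auto simp: A_def)
    then show ?thesis using ultrafilter_nat_cases by blast
  qed
  then have "\<forall>i\<in>{1..m} - A. \<exists>k. eventually (\<lambda>n. n = k) (U i)" by blast
  from bchoice[OF this] obtain k where k: "\<forall>i\<in>{1..m} - A. eventually (\<lambda>n. n = k i) (U i)" by blast
  define c where "c i = x i (k i)" for i
  have xT: "x i n \<in> Tz" "tz_norm (x i n) = 1" if "i \<in> {1..m}" for i n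
    using x that by (auto simp: normalized_seq_on_def)
  have 1: "A \<subseteq> {1..m}" by (auto simp: A_def)
  have 3: "c i \<in> Tz \<and> eventually (\<lambda>n. x i n = c i) (U i)" if "i \<in> {1..m} - A" for i
  proof -
    have "eventually (\<lambda>n. n = k i) (U i)" using k that by blast
    then have "eventually (\<lambda>n. x i n = c i) (U i)" by (rule eventually_mono) (simp add: c_def)
    then show ?thesis using xT that by (simp add: c_def)
  qed
  have 4: "x i n \<in> Tz \<and> tz_norm (x i n) = 1" if "i \<in> A" for i n using xT that 1 by blast
  have 5: "((\<lambda>n. x i n p) \<longlongrightarrow> 0) (U i)" if "i \<in> A" for i p
  proof -
    have "(\<lambda>n. coord p (x i n)) \<longlonglongrightarrow> 0"
      using x that 1 coord_dual unfolding weakly_null_on_def by blast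
    then have "(\<lambda>n. x i n p) \<longlonglongrightarrow> 0" using 4[OF that] by (simp add: coord_def)
    then show ?thesis by (rule tendsto_mono[rotated]) (use that in \<open>simp add: A_def\<close>)
  qed
  have hyp: "\<forall>i\<in>{1..m} - A. c i \<in> Tz \<and> eventually (\<lambda>n. x i n = c i) (U i)"
    "\<forall>i\<in>A. \<forall>n. x i n \<in> Tz \<and> tz_norm (x i n) = 1"
    "\<forall>i\<in>A. \<forall>p. ((\<lambda>n. x i n p) \<longlongrightarrow> 0) (U i)"
    using 3 4 5 by blast+
  note est = iterated_norm_estimate[OF 1 U hyp]
  show ?thesis using est(1)[OF permutes_id] est(2,3)[OF \<sigma>] by simp
qed

section \<open>Failure of asymptotic symmetry for weighted sequences\<close>

text \<open>
  Zorn's lemma for the filters below \<open>G\<close>: the infimum of a chain of proper filters is proper.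
\<close>

lemma ultrafilter_below:
  fixes G :: "'a filter"
  assumes "G \<noteq> bot"
  obtains U where "ultrafilter U" "U \<le> G"
proof -
  let ?A = "{F. F \<noteq> bot \<and> F \<le> G}"
  let ?P = "\<lambda>F F' :: 'a filter. F' \<le> F"
  have "\<exists>m\<in>?A. \<forall>a\<in>?A. ?P m a \<longrightarrow> a = m"
  proof (rule predicate_Zorn)
    show "partial_order_on ?A (relation_of ?P ?A)"
      by (rule partial_order_on_relation_ofI) auto
    fix C assume C: "C \<in> Chains (relation_of ?P ?A)"
    have sub: "C \<subseteq> ?A" and total: "\<And>F F'. F \<in> C \<Longrightarrow> F' \<in> C \<Longrightarrow> F \<le> F' \<or> F' \<le> F"
      using C by (auto simp: Chains_def relation_of_def)
    show "\<exists>u\<in>?A. \<forall>a\<in>C. ?P a u"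
    proof (cases "C = {}")
      case True then show ?thesis using assms by blast
    next
      case False
      have closed: "Inf X \<in> C" if "finite X" "X \<noteq> {}" "X \<subseteq> C" for X
        using that
      proof (induction X rule: finite_ne_induct)
        case (insert F X)
        then have "Inf X \<in> C" "F \<in> C" by auto
        then show ?case using total[of F "Inf X"] by (auto simp: inf_absorb1 inf_absorb2)
      qed simp
      have not_bot: "Inf X \<noteq> bot" if "finite X" "X \<subseteq> C" for X
      proof (cases "X = {}")
        case True
        have "(top :: 'a filter) \<noteq> bot" using assms by (metis bot.extremum_uniqueI top_greatest)
        then show ?thesis using True by simp
      next
        case False
        then have "Inf X \<in> ?A" by (intro subsetD[OF sub] closed that)
        then show ?thesis by simp
      qed
      have "Inf C \<noteq> bot" by (rule Inf_filter_not_bot) (rule not_bot)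
      moreover have "Inf C \<le> G"
      proof -
        obtain F where "F \<in> C" using False by blast
        then show ?thesis using sub by (intro Inf_lower2[of F]) auto
      qed
      ultimately show ?thesis by (intro bexI[of _ "Inf C"]) (auto intro: Inf_lower)
    qed
  qed
  then obtain U where U: "U \<noteq> bot" "U \<le> G" "\<And>F. F \<noteq> bot \<Longrightarrow> F \<le> G \<Longrightarrow> F \<le> U \<Longrightarrow> F = U" by auto
  have "eventually Q U \<or> eventually (\<lambda>x. \<not> Q x) U" for Q
  proof (rule disjCI)
    assume not: "\<not> eventually (\<lambda>x. \<not> Q x) U"
    have "inf U (principal {x. Q x}) \<noteq> bot"
      using not by (simp add: trivial_limit_def eventually_inf_principal)
    then have "inf U (principal {x. Q x}) = U" using U(2) by (intro U(3)) (auto intro: le_infI1)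
    moreover have "eventually Q (inf U (principal {x. Q x}))" by (simp add: eventually_inf_principal)
    ultimately show "eventually Q U" by simp
  qed
  then show ?thesis using that U by (auto simp: ultrafilter_def)
qed

text \<open>
  If at least \<open>i\<close> terms are as large as \<open>f s\<close>, then \<open>f s \<le> b / \<surd>i\<close>; so the sum is dominated by
  \<open>b \<Sum>\<^sub>i 1 / \<surd>i \<le> 2 b \<surd>n\<close>. The proof removes a smallest term.
\<close>

lemma sum_le_rank:
  fixes f :: "'a \<Rightarrow> real"
  assumes "finite S" "0 \<le> b" "\<And>s. s \<in> S \<Longrightarrow> 0 \<le> f s"
    and "\<And>s. s \<in> S \<Longrightarrow> real (card {t\<in>S. f s \<le> f t}) * (f s)\<^sup>2 \<le> b\<^sup>2"
  shows "(\<Sum>s\<in>S. f s) \<le> 2 * b * sqrt (card S)"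
  using assms(1,3,4)
proof (induction "card S" arbitrary: S)
  case 0
  then show ?case by simp
next
  case (Suc n)
  then have ne: "S \<noteq> {}" and fin: "finite S" by auto
  obtain s where s: "s \<in> S" "\<And>t. t \<in> S \<Longrightarrow> f s \<le> f t"
    using ex_min_if_finite[of "f ` S"] fin ne by (metis (mono_tags, lifting) arg_min_if_finite(1) arg_min_if_finite(2) not_le)
  let ?T = "S - {s}"
  have cT: "n = card ?T" using Suc.hyps(2) s(1) fin by simp
  have IH: "(\<Sum>t\<in>?T. f t) \<le> 2 * b * sqrt (card ?T)"
  proof (rule Suc.hyps(1)[OF cT])
    show "finite ?T" using fin by simp
    show "0 \<le> f t" if "t \<in> ?T" for t using that Suc.prems(2) by simp
    fix t assume t: "t \<in> ?T"
    have "card {u\<in>?T. f t \<le> f u} \<le> card {u\<in>S. f t \<le> f u}" using fin by (intro card_mono) auto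
    then have "real (card {u\<in>?T. f t \<le> f u}) * (f t)\<^sup>2 \<le> real (card {u\<in>S. f t \<le> f u}) * (f t)\<^sup>2"
      by (intro mult_right_mono) auto
    also have "\<dots> \<le> b\<^sup>2" using Suc.prems(3) t by simp
    finally show "real (card {u\<in>?T. f t \<le> f u}) * (f t)\<^sup>2 \<le> b\<^sup>2" .
  qed
  have "{t\<in>S. f s \<le> f t} = S" using s(2) by auto
  then have "real (Suc n) * (f s)\<^sup>2 \<le> b\<^sup>2" using Suc.prems(3)[OF s(1)] Suc.hyps(2) by simp
  then have "sqrt (real (Suc n) * (f s)\<^sup>2) \<le> sqrt (b\<^sup>2)" by (rule real_sqrt_le_mono)
  then have fs: "sqrt (Suc n) * f s \<le> b" using Suc.prems(2)[OF s(1)] assms(2) by (simp add: real_sqrt_mult)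
  define p where "p = sqrt (Suc n)"
  define q where "q = sqrt n"
  have pq: "0 < p" "0 \<le> q" "p\<^sup>2 = q\<^sup>2 + 1" by (auto simp: p_def q_def)
  have "p * (f s + 2 * b * q) \<le> p * (2 * b * p)"
  proof -
    have "2 * (p * q) \<le> p\<^sup>2 + q\<^sup>2" using sum_squares_bound[of p q] by (simp add: mult.assoc)
    then have "b * (2 * (p * q)) \<le> b * (2 * p\<^sup>2 - 1)" using pq(3) assms(2) by (intro mult_left_mono) auto
    then show ?thesis using fs unfolding p_def[symmetric] by (simp add: algebra_simps power2_eq_square)
  qed
  then have "f s + 2 * b * q \<le> 2 * b * p" using pq(1) by simp
  moreover have "(\<Sum>t\<in>S. f t) = f s + (\<Sum>t\<in>?T. f t)" using fin s(1) by (rule sum.remove)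
  ultimately show ?case using IH unfolding cT[symmetric] Suc.hyps(2)[symmetric] p_def q_def by simp
qed

text \<open>
  In each interval, suppose that the number of coordinates as large as a given one, times the square of the
  latter, is at most twice the square of the largest coordinate. Then no functional beats the
  largest coordinate. Inductively, each part \<open>T\<^sub>i\<close> is worth at most one coordinate \<open>h\<^sub>i\<close> from its convex hull, the
  hulls are disjoint, and by \<open>sum_le_rank\<close> the sum of \<open>m\<close> distinct coordinates is at most \<open>2 \<surd>2 \<surd>m\<close> times the
  largest one. The factor \<open>1 / (3 \<surd>m)\<close> more than compensates for this.
\<close>

lemma val_le_peak:
  assumes peak: "\<And>a b s t. s \<in> {a..b} \<Longrightarrow> x s \<noteq> 0 \<Longrightarrow> (\<And>n. n \<in> {a..b} \<Longrightarrow> \<bar>x n\<bar> \<le> t) \<Longrightarrow>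
      real (card {n\<in>{a..b}. \<bar>x s\<bar> \<le> \<bar>x n\<bar>}) * (x s)\<^sup>2 \<le> 2 * t\<^sup>2"
    and v: "val x S r" and S: "S \<subseteq> {a..b}" "a \<le> b"
  shows "\<exists>n\<in>{a..b}. r \<le> \<bar>x n\<bar>"
  using v S
proof (induction arbitrary: a b rule: val.induct)
  case (unit n S)
  then show ?case by blast
next
  case (comb I T S r)
  define I' where "I' = {i\<in>I. T i \<noteq> {}}"
  have I': "finite I'" "I' \<subseteq> I" using comb.hyps(1) by (auto simp: I'_def)
  have sub: "T i \<subseteq> {a..b}" if "i \<in> I" for i using comb.hyps(2) comb.prems(1) that by blast
  have finT: "finite (T i)" if "i \<in> I" for i using sub[OF that] finite_subset by blast
  have "\<exists>n\<in>{Min (T i)..Max (T i)}. r i \<le> \<bar>x n\<bar>" if "i \<in> I'" for i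
  proof -
    have i: "i \<in> I" "T i \<noteq> {}" using that by (auto simp: I'_def)
    have "T i \<subseteq> {Min (T i)..Max (T i)}" "Min (T i) \<le> Max (T i)" using finT[OF i(1)] i(2) by auto
    then show ?thesis using comb.IH i(1) by simp
  qed
  then obtain h where h: "\<And>i. i \<in> I' \<Longrightarrow> h i \<in> {Min (T i)..Max (T i)}" "\<And>i. i \<in> I' \<Longrightarrow> r i \<le> \<bar>x (h i)\<bar>"
    by metis
  have hab: "h i \<in> {a..b}" if "i \<in> I'" for i
  proof -
    have i: "i \<in> I" "T i \<noteq> {}" using that by (auto simp: I'_def)
    have "Min (T i) \<in> {a..b}" "Max (T i) \<in> {a..b}"
      using Min_in[OF finT[OF i(1)] i(2)] Max_in[OF finT[OF i(1)] i(2)] sub[OF i(1)] by blast+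
    then show ?thesis using h(1)[OF that] by auto
  qed
  have lt: "h i < h j" if "i \<in> I'" "j \<in> I'" "i < j" for i j
  proof -
    have ij: "i \<in> I" "T i \<noteq> {}" "j \<in> I" "T j \<noteq> {}" using that by (auto simp: I'_def)
    have "Max (T i) < Min (T j)"
      using successiveD[OF comb.hyps(3) ij(1,3) that(3)] Max_in[OF finT[OF ij(1)] ij(2)] Min_in[OF finT[OF ij(3)] ij(4)] by blast
    then show ?thesis using h(1)[OF that(1)] h(1)[OF that(2)] by simp
  qed
  have inj: "inj_on h I'" by (rule linorder_inj_onI') (use lt in \<open>auto dest: less_imp_neq\<close>)
  define t where "t = Max ((\<lambda>n. \<bar>x n\<bar>) ` {a..b})"
  have t: "\<bar>x n\<bar> \<le> t" if "n \<in> {a..b}" for n unfolding t_def using that by (intro Max_ge) auto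
  have "t \<in> (\<lambda>n. \<bar>x n\<bar>) ` {a..b}" unfolding t_def using comb.prems(2) by (intro Max_in) auto
  then obtain n where n: "n \<in> {a..b}" "t = \<bar>x n\<bar>" by blast
  have t0: "0 \<le> t" using n by simp
  \<comment> \<open>The rank condition holds with \<open>b = 3 t / 2\<close> because \<open>2 t\<^sup>2 \<le> (3 t / 2)\<^sup>2\<close>.\<close>
  have "(\<Sum>s\<in>h ` I'. \<bar>x s\<bar>) \<le> 2 * (3/2 * t) * sqrt (card (h ` I'))"
  proof (rule sum_le_rank)
    fix s assume s: "s \<in> h ` I'"
    then have sab: "s \<in> {a..b}" using hab by auto
    show "real (card {u\<in>h ` I'. \<bar>x s\<bar> \<le> \<bar>x u\<bar>}) * \<bar>x s\<bar>\<^sup>2 \<le> (3/2 * t)\<^sup>2"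
    proof (cases "x s = 0")
      case False
      have "card {u\<in>h ` I'. \<bar>x s\<bar> \<le> \<bar>x u\<bar>} \<le> card {n\<in>{a..b}. \<bar>x s\<bar> \<le> \<bar>x n\<bar>}"
        using hab by (intro card_mono) auto
      then have "real (card {u\<in>h ` I'. \<bar>x s\<bar> \<le> \<bar>x u\<bar>}) * \<bar>x s\<bar>\<^sup>2 \<le> real (card {n\<in>{a..b}. \<bar>x s\<bar> \<le> \<bar>x n\<bar>}) * (x s)\<^sup>2"
        by (simp add: mult_right_mono)
      also have "\<dots> \<le> 2 * t\<^sup>2" using sab False t by (rule peak)
      also have "\<dots> \<le> (3/2 * t)\<^sup>2" by (simp add: power_mult_distrib power_divide)
      finally show ?thesis .
    qed simp
  qed (use I' t0 in auto)
  moreover have "(\<Sum>i\<in>I'. r i) \<le> (\<Sum>s\<in>h ` I'. \<bar>x s\<bar>)"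
    unfolding sum.reindex[OF inj] by (rule sum_mono) (simp add: h(2))
  moreover have "(\<Sum>i\<in>I. r i) = (\<Sum>i\<in>I'. r i)"
  proof (rule sum.mono_neutral_right[OF comb.hyps(1) I'(2)])
    have "r i = 0" if "i \<in> I" "T i = {}" for i
    proof -
      have "val x (T i) (r i)" using comb.IH that(1) by simp
      then show ?thesis unfolding that(2) by (rule val_empty)
    qed
    then show "\<forall>i\<in>I - I'. r i = 0" by (auto simp: I'_def)
  qed
  moreover have "sqrt (card (h ` I')) \<le> sqrt (card I)"
    using card_image_le[OF I'(1), of h] card_mono[OF comb.hyps(1) I'(2)] by simp
  ultimately have "(\<Sum>i\<in>I. r i) \<le> t * (3 * sqrt (card I))"
    using mult_left_mono[of "sqrt (card (h ` I'))" "sqrt (card I)" "3 * t"] t0 by simp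
  then have "(\<Sum>i\<in>I. r i) / (3 * sqrt (card I)) \<le> t"
    using t0 by (cases "card I = 0") (auto simp: pos_divide_le_eq)
  then show ?case using n by auto
qed

text \<open>
  An interval without multiples of \<open>2\<^sup>V\<^sup>+\<^sup>1\<close> lies within one residue period of this modulus, and a period has
  \<open>2\<^sup>V\<^sup>+\<^sup>1\<^sup>-\<^sup>k\<close> multiples of \<open>2\<^sup>k\<close>.
\<close>

lemma card_multiples_le:
  fixes lo hi :: nat
  assumes "\<And>p. p \<in> {lo..hi} \<Longrightarrow> \<not> 2 ^ Suc V dvd p" and k: "k \<le> V"
  shows "card {p\<in>{lo..hi}. 2 ^ k dvd p} \<le> 2 ^ (Suc V - k)"
proof -
  define M :: nat where "M = 2 ^ Suc V"
  have M: "0 < M" "M = 2 ^ k * 2 ^ (Suc V - k)" using k by (auto simp: M_def simp flip: power_add)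
  define g where "g p = p mod M div 2 ^ k" for p :: nat
  have key: False if "p \<in> {lo..hi}" "p' \<in> {lo..hi}" "p < p'" "p mod M = p' mod M" for p p'
  proof -
    have "M dvd p' - p" using that(3,4) mod_eq_dvd_iff_nat[of p p' M] by simp
    then have "M \<le> p' - p" using that(3) by (intro dvd_imp_le) auto
    moreover have "p' mod M < M" using M(1) by simp
    ultimately have "p' - p' mod M \<in> {lo..hi}" using that by auto
    moreover have "M dvd p' - p' mod M" by (rule dvd_minus_mod)
    ultimately show False using assms(1) unfolding M_def by blast
  qed
  have "inj_on g {p\<in>{lo..hi}. 2 ^ k dvd p}"
  proof (rule inj_onI)
    fix p p' assume p: "p \<in> {p\<in>{lo..hi}. 2 ^ k dvd p}" "p' \<in> {p\<in>{lo..hi}. 2 ^ k dvd p}" and "g p = g p'"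
    have "2 ^ k dvd M" using M(2) by simp
    then have "2 ^ k dvd p mod M" "2 ^ k dvd p' mod M" using p by (simp_all add: dvd_mod)
    then have "p mod M = p' mod M" using \<open>g p = g p'\<close> unfolding g_def by (metis dvd_div_mult_self)
    then show "p = p'" using key[of p p'] key[of p' p] p by (metis (no_types, lifting) linorder_neqE_nat mem_Collect_eq)
  qed
  moreover have "g ` {p\<in>{lo..hi}. 2 ^ k dvd p} \<subseteq> {..<2 ^ (Suc V - k)}"
  proof (clarsimp simp: g_def)
    fix p
    have "p mod M < 2 ^ k * 2 ^ (Suc V - k)" using M by (metis mod_less_divisor)
    then show "p mod M div 2 ^ k < 2 ^ (Suc V - k)" by (simp add: less_mult_imp_div_less mult.commute)
  qed
  ultimately have "card {p\<in>{lo..hi}. 2 ^ k dvd p} \<le> card {..<2 ^ (Suc V - k) :: nat}"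
    by (intro card_inj_on_le) auto
  then show ?thesis by simp
qed

text \<open>
  Along a nonprincipal ultrafilter a variable that is bound later eventually exceeds those that are already
  fixed, so only assignments matter that increase in the order of the variables.
\<close>

lemma iterated_Lim_increasing:
  assumes W: "ultrafilter W" "W \<le> sequentially" and d: "distinct is"
    and F: "\<And>\<nu>. (\<And>p q. p < q \<Longrightarrow> q < length is \<Longrightarrow> \<nu> (is ! p) < \<nu> (is ! q)) \<Longrightarrow> a \<le> F \<nu> \<and> F \<nu> \<le> b"
  shows "a \<le> iterated_Lim (\<lambda>_. W) F is \<mu> \<and> iterated_Lim (\<lambda>_. W) F is \<mu> \<le> b"
proof -
  define P where "P js \<nu> \<longleftrightarrow> (\<exists>k\<le>length is. js = drop k is \<and> (\<forall>q<k. \<forall>p<q. \<nu> (is ! p) < \<nu> (is ! q)))"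
    for js and \<nu> :: "nat \<Rightarrow> nat"
  have step: "eventually (\<lambda>n. P js (\<nu>(i := n))) W" if P: "P (i # js) \<nu>" for i js \<nu>
  proof -
    obtain k where k: "k \<le> length is" "i # js = drop k is" "\<forall>q<k. \<forall>p<q. \<nu> (is ! p) < \<nu> (is ! q)"
      using P unfolding P_def by blast
    have kl: "k < length is" using k(1,2) by (metis drop_all le_neq_implies_less list.distinct(1) order_refl)
    have i: "i = is ! k" "js = drop (Suc k) is"
      using trans[OF k(2) Cons_nth_drop_Suc[OF kl, symmetric]] by simp_all
    have ne: "is ! p \<noteq> i" if "p < k" for p
      using that kl d unfolding i(1) by (simp add: nth_eq_iff_index_eq)
    have "eventually (\<lambda>n. \<forall>p\<in>{..<k}. \<nu> (is ! p) < n) sequentially"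
      by (intro eventually_ball_finite) (auto intro: eventually_gt_at_top)
    then have "eventually (\<lambda>n. \<forall>p\<in>{..<k}. \<nu> (is ! p) < n) W" using W(2) by (rule filter_leD[rotated])
    then show ?thesis
    proof (rule eventually_mono)
      fix n assume n: "\<forall>p\<in>{..<k}. \<nu> (is ! p) < n"
      have "(\<nu>(i := n)) (is ! p) < (\<nu>(i := n)) (is ! q)" if "q < Suc k" "p < q" for p q
      proof (cases "q = k")
        case True
        then show ?thesis using n ne[of p] that i(1) by simp
      next
        case False
        then show ?thesis using k(3) ne[of p] ne[of q] that by simp
      qed
      then show "P js (\<nu>(i := n))" unfolding P_def using i(2) kl by (intro exI[of _ "Suc k"]) auto
    qed
  qed
  have final: "a \<le> F \<nu> \<and> F \<nu> \<le> b" if P: "P [] \<nu>" for \<nu>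
  proof -
    obtain k where "k \<le> length is" "[] = drop k is" "\<forall>q<k. \<forall>p<q. \<nu> (is ! p) < \<nu> (is ! q)"
      using P unfolding P_def by blast
    then show ?thesis by (intro F) auto
  qed
  have "P is \<mu>" unfolding P_def by (intro exI[of _ 0]) auto
  then show ?thesis by (intro iterated_Lim_between[where P = P] W step final)
qed

text \<open>
  The marks on a ruler, or the in-order traversal of a binary tree whose nodes at height \<open>v\<close> carry the
  weight \<open>2\<^sup>v\<^sup>/\<^sup>2\<close>.
\<close>

definition ruler :: "nat \<Rightarrow> real" where
  "ruler p = sqrt (2 ^ multiplicity 2 p)"

lemma ruler_mono_iff: "ruler p \<le> ruler q \<longleftrightarrow> multiplicity 2 p \<le> multiplicity 2 q"
  by (simp add: ruler_def)

lemma ruler_pos: "0 < ruler p" by (simp add: ruler_def)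

lemma ruler_peak:
  assumes lo: "0 < lo" and s: "s \<in> {lo..hi}" and t: "\<And>p. p \<in> {lo..hi} \<Longrightarrow> ruler p \<le> t"
  shows "real (card {p\<in>{lo..hi}. ruler s \<le> ruler p}) * (ruler s)\<^sup>2 \<le> 2 * t\<^sup>2"
proof -
  define V where "V = Max (multiplicity 2 ` {lo..hi})"
  define k where "k = multiplicity 2 s"
  have le: "multiplicity 2 p \<le> V" if "p \<in> {lo..hi}" for p unfolding V_def using that by (intro Max_ge) auto
  have "V \<in> multiplicity 2 ` {lo..hi}" unfolding V_def using s by (intro Max_in) auto
  then obtain p0 where p0: "p0 \<in> {lo..hi}" "V = multiplicity 2 p0" by blast
  have dvd_iff: "2 ^ j dvd p \<longleftrightarrow> j \<le> multiplicity 2 p" if "p \<in> {lo..hi}" for j p :: nat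
    using that lo by (intro power_dvd_iff_le_multiplicity) auto
  have "k \<le> V" unfolding k_def by (rule le[OF s])
  have "card {p\<in>{lo..hi}. ruler s \<le> ruler p} = card {p\<in>{lo..hi}. 2 ^ k dvd p}"
    using dvd_iff by (intro arg_cong[of _ _ card] Collect_cong) (auto simp: ruler_mono_iff k_def)
  also have "\<dots> \<le> 2 ^ (Suc V - k)"
  proof (rule card_multiples_le)
    show "\<not> 2 ^ Suc V dvd p" if "p \<in> {lo..hi}" for p
      using dvd_iff[OF that, of "Suc V"] le[OF that] by simp
  qed (rule \<open>k \<le> V\<close>)
  finally have "real (card {p\<in>{lo..hi}. ruler s \<le> ruler p}) * (ruler s)\<^sup>2 \<le> 2 ^ (Suc V - k) * 2 ^ k"
    by (simp add: ruler_def k_def)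
  also have "\<dots> = (2::real) * 2 ^ V" using \<open>k \<le> V\<close> by (simp flip: power_add)
  also have "2 ^ V = (ruler p0)\<^sup>2" by (simp add: ruler_def p0(2))
  also have "2 * (ruler p0)\<^sup>2 \<le> 2 * t\<^sup>2"
    using t[OF p0(1)] ruler_pos[of p0] by (intro mult_left_mono power_mono) auto
  finally show ?thesis by simp
qed

lemma basis_combination_apply:
  assumes "finite I" "inj_on \<nu> I" "i \<in> I"
  shows "(\<Sum>j\<in>I. a j *\<^sub>R basis (\<nu> j)) (\<nu> i) = a i"
proof -
  have "(\<Sum>j\<in>I. a j *\<^sub>R basis (\<nu> j)) (\<nu> i) = (\<Sum>j\<in>I. if j = i then a j else 0)"
    unfolding fun_sum_apply by (rule sum.cong) (use assms in \<open>auto simp: basis_def inj_on_def\<close>)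
  then show ?thesis using assms by simp
qed

lemma basis_combination_outside:
  assumes "n \<notin> \<nu> ` I"
  shows "(\<Sum>j\<in>I. a j *\<^sub>R basis (\<nu> j)) n = 0"
  unfolding fun_sum_apply using assms by (intro sum.neutral) (auto simp: basis_def)

lemma basis_combination_Tz: "(\<Sum>j\<in>I. a j *\<^sub>R basis (\<nu> j)) \<in> Tz"
  by (intro sum_Tz scale_Tz basis_Tz)

lemma ruler_order_upper:
  assumes mono: "\<And>p q. p \<in> {1..m} \<Longrightarrow> q \<in> {1..m} \<Longrightarrow> p < q \<Longrightarrow> n p < n q"
    and t: "\<And>p. p \<in> {1..m} \<Longrightarrow> ruler p \<le> t" "0 \<le> t"
  shows "tz_norm (\<Sum>p=1..m. ruler p *\<^sub>R basis (n p)) \<le> t"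
proof -
  define x where "x = (\<Sum>p=1..m. ruler p *\<^sub>R basis (n p))"
  have inj: "inj_on n {1..m}" by (rule linorder_inj_onI') (use mono in \<open>auto dest: less_imp_neq\<close>)
  have xn: "x (n p) = ruler p" if "p \<in> {1..m}" for p
    unfolding x_def by (rule basis_combination_apply) (use inj that in auto)
  have x0: "x k = 0" if "k \<notin> n ` {1..m}" for k
    unfolding x_def by (rule basis_combination_outside[OF that])
  have xT: "x \<in> Tz" unfolding x_def by (rule basis_combination_Tz)
  have peak: "real (card {k\<in>{a..b}. \<bar>x s\<bar> \<le> \<bar>x k\<bar>}) * (x s)\<^sup>2 \<le> 2 * u\<^sup>2"
    if s: "s \<in> {a..b}" "x s \<noteq> 0" and u: "\<And>k. k \<in> {a..b} \<Longrightarrow> \<bar>x k\<bar> \<le> u" for a b s u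
  proof -
    \<comment> \<open>The indices of the coordinates in \<open>{a..b}\<close> form an interval, to which \<open>ruler_peak\<close> applies.\<close>
    define Q where "Q = {p\<in>{1..m}. n p \<in> {a..b}}"
    obtain q where q: "q \<in> {1..m}" "s = n q" using x0[of s] s(2) by blast
    have qQ: "q \<in> Q" using q s(1) by (simp add: Q_def)
    have fin: "finite Q" by (simp add: Q_def)
    define lo where "lo = Min Q"
    define hi where "hi = Max Q"
    have lohi: "lo \<in> Q" "hi \<in> Q" unfolding lo_def hi_def using qQ fin by (auto intro!: Min_in Max_in)
    have Q_eq: "Q = {lo..hi}"
    proof
      show "Q \<subseteq> {lo..hi}" unfolding lo_def hi_def using fin by auto
      show "{lo..hi} \<subseteq> Q"
      proof
        fix p assume p: "p \<in> {lo..hi}"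
        have pm: "p \<in> {1..m}" using p lohi by (auto simp: Q_def)
        have "n lo \<le> n p" using mono[of lo p] lohi(1) pm p by (cases "lo = p") (auto simp: Q_def less_imp_le)
        moreover have "n p \<le> n hi" using mono[of p hi] lohi(2) pm p by (cases "p = hi") (auto simp: Q_def less_imp_le)
        ultimately show "p \<in> Q" using lohi pm by (auto simp: Q_def)
      qed
    qed
    have "{k\<in>{a..b}. \<bar>x s\<bar> \<le> \<bar>x k\<bar>} \<subseteq> n ` {p\<in>{lo..hi}. ruler q \<le> ruler p}"
    proof
      fix k assume k: "k \<in> {k\<in>{a..b}. \<bar>x s\<bar> \<le> \<bar>x k\<bar>}"
      then have "x k \<noteq> 0" using s(2) by auto
      then obtain p where p: "p \<in> {1..m}" "k = n p" using x0[of k] by blast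
      have "ruler q \<le> ruler p" using k q p xn ruler_pos[of p] ruler_pos[of q] by simp
      moreover have "p \<in> {lo..hi}" using k p Q_eq by (auto simp: Q_def)
      ultimately show "k \<in> n ` {p\<in>{lo..hi}. ruler q \<le> ruler p}" using p(2) by blast
    qed
    then have "card {k\<in>{a..b}. \<bar>x s\<bar> \<le> \<bar>x k\<bar>} \<le> card {p\<in>{lo..hi}. ruler q \<le> ruler p}"
      by (rule surj_card_le[rotated]) simp
    then have "real (card {k\<in>{a..b}. \<bar>x s\<bar> \<le> \<bar>x k\<bar>}) * (x s)\<^sup>2
        \<le> real (card {p\<in>{lo..hi}. ruler q \<le> ruler p}) * (ruler q)\<^sup>2"
      using xn[OF q(1)] q(2) by (simp add: mult_right_mono)
    also have "\<dots> \<le> 2 * u\<^sup>2"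
    proof (rule ruler_peak)
      show "0 < lo" using lohi by (simp add: Q_def)
      show "q \<in> {lo..hi}" using qQ Q_eq by simp
      show "ruler p \<le> u" if "p \<in> {lo..hi}" for p
      proof -
        have "p \<in> Q" unfolding Q_eq by (rule that)
        then have "p \<in> {1..m}" "n p \<in> {a..b}" unfolding Q_def by blast+
        then show ?thesis using u[of "n p"] xn[of p] by simp
      qed
    qed
    finally show ?thesis .
  qed
  have xt: "\<bar>x k\<bar> \<le> t" for k
  proof (cases "k \<in> n ` {1..m}")
    case True
    then show ?thesis using xn t(1) ruler_pos by (auto simp: abs_of_pos)
  qed (use x0 t(2) in simp)
  have "r \<le> t" if r: "val x UNIV r" for r
  proof -
    define b where "b = Max (insert 0 (n ` {1..m}))"
    have b: "n p \<le> b" if "p \<in> {1..m}" for p unfolding b_def using that by (intro Max_ge) auto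
    have "cut {..b} x = x" using x0 b by (force simp: fun_eq_iff)
    then have "val x (UNIV \<inter> {..b}) r" using r val_cut by metis
    then have "\<exists>k\<in>{0..b}. r \<le> \<bar>x k\<bar>" by (intro val_le_peak[OF peak]) auto
    then show ?thesis using xt order_trans by blast
  qed
  then show ?thesis unfolding x_def[symmetric] tz_norm_def by (rule nrm_le)
qed

text \<open>
  Two applications of the lower estimate: the \<open>2\<^sup>l\<close> equal coefficients of level \<open>l\<close> have norm at least \<open>h / 3\<close>,
  and then the \<open>L\<close> levels count as \<open>L\<close> blocks of that norm.
\<close>

lemma level_order_lower:
  fixes n :: "nat \<Rightarrow> nat"
  assumes mono: "\<And>i j. i \<in> {1..<2 ^ L} \<Longrightarrow> j \<in> {1..<2 ^ L} \<Longrightarrow> i < j \<Longrightarrow> n i < n j"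
    and a: "\<And>l i. l < L \<Longrightarrow> i \<in> {2 ^ l..<2 ^ Suc l} \<Longrightarrow> a i * sqrt (2 ^ l) = h" and h: "0 \<le> h"
  shows "h * sqrt L / 9 \<le> tz_norm (\<Sum>i\<in>{1..<2 ^ L}. a i *\<^sub>R basis (n i))"
proof -
  define x where "x = (\<Sum>i\<in>{1..<2 ^ L}. a i *\<^sub>R basis (n i))"
  have xT: "x \<in> Tz" unfolding x_def by (rule basis_combination_Tz)
  have inj: "inj_on n {1..<2 ^ L}" by (rule linorder_inj_onI') (use mono in \<open>auto dest: less_imp_neq\<close>)
  have xn: "x (n i) = a i" if "i \<in> {1..<2 ^ L}" for i
    unfolding x_def by (rule basis_combination_apply) (use inj that in auto)
  define D where "D l = {(2::nat) ^ l..<2 ^ Suc l}" for l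
  have D: "D l \<subseteq> {1..<2 ^ L}" if "l < L" for l
  proof -
    have "(2::nat) ^ Suc l \<le> 2 ^ L" using that by (intro power_increasing) auto
    moreover have "(1::nat) \<le> 2 ^ l" by simp
    ultimately show ?thesis unfolding D_def by (intro ivl_subset[THEN iffD2] disjI2 conjI)
  qed
  have block: "h / 3 \<le> nrm x (n ` D l)" if l: "l < L" for l
  proof -
    define s where "s = h / sqrt (2 ^ l)"
    have "s * sqrt (real (card (D l))) / 3 \<le> nrm x (n ` D l)"
    proof (rule lower_estimate_const[OF xT, of _ "\<lambda>i. {n i}"])
      show "finite (D l)" by (simp add: D_def)
      show "{n i} \<subseteq> n ` D l" if "i \<in> D l" for i using that by simp
      show "successive (D l) (\<lambda>i. {n i})"
        unfolding successive_def using mono D[OF l] by (auto simp: subset_iff)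
      show "s \<le> nrm x {n i}" if i: "i \<in> D l" for i
      proof -
        have "a i = s" using a[OF l, of i] i by (simp add: s_def D_def field_simps)
        then have "s = x (n i)" using xn i D[OF l] by auto
        then show ?thesis using abs_le_nrm[OF xT, of "n i" "{n i}"] by simp
      qed
    qed
    then show ?thesis by (simp add: s_def D_def)
  qed
  have "h / 3 * sqrt (card {..<L}) / 3 \<le> nrm x UNIV"
  proof (rule lower_estimate_const[OF xT, of _ "\<lambda>l. n ` D l"])
    show "successive {..<L} (\<lambda>l. n ` D l)"
      unfolding successive_def
    proof (intro ballI impI)
      fix l l' p q assume *: "l \<in> {..<L}" "l' \<in> {..<L}" "l < l'" "p \<in> n ` D l" "q \<in> n ` D l'"
      obtain i j where ij: "i \<in> D l" "p = n i" "j \<in> D l'" "q = n j" using * by blast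
      have "(2::nat) ^ Suc l \<le> 2 ^ l'" using *(3) by (intro power_increasing) auto
      then have "i < j" using ij(1,3) unfolding D_def by simp
      moreover have "i \<in> {1..<2 ^ L}" "j \<in> {1..<2 ^ L}" using D[of l] D[of l'] *(1,2) ij(1,3) by blast+
      ultimately show "p < q" unfolding ij(2,4) by (intro mono)
    qed
  qed (use block in auto)
  then show ?thesis unfolding x_def[symmetric] by (simp add: tz_norm_def)
qed

text \<open>
  Renumbers the nodes of the binary tree from in-order to level order: the position \<open>p = 2\<^sup>v (2 q + 1)\<close> belongs
  to the \<open>q\<close>-th node of level \<open>L - 1 - v\<close>.
\<close>

definition level_index :: "nat \<Rightarrow> nat \<Rightarrow> nat" where
  "level_index L p = (if p \<in> {1..<2 ^ L}
     then 2 ^ (L - 1 - multiplicity 2 p) + p div 2 ^ Suc (multiplicity 2 p) else p)"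

lemma level_index_range:
  assumes p: "p \<in> {1..<2 ^ L}"
  shows "multiplicity 2 p < L"
    "level_index L p \<in> {2 ^ (L - 1 - multiplicity 2 p)..<2 ^ Suc (L - 1 - multiplicity 2 p)}"
proof -
  let ?v = "multiplicity 2 p"
  have "2 ^ ?v dvd p" by (rule multiplicity_dvd)
  then have "2 ^ ?v \<le> p" using p by (intro dvd_imp_le) auto
  also have "p < 2 ^ L" using p by simp
  finally show v: "?v < L" by simp
  have "(2::nat) ^ L = 2 ^ Suc ?v * 2 ^ (L - 1 - ?v)" using v by (simp flip: power_add power_Suc)
  then have "p div 2 ^ Suc ?v < 2 ^ (L - 1 - ?v)"
    using p by (intro less_mult_imp_div_less) (simp add: mult.commute)
  then show "level_index L p \<in> {2 ^ (L - 1 - ?v)..<2 ^ Suc (L - 1 - ?v)}"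
    using p by (simp add: level_index_def)
qed

lemma dyadic_level_unique:
  fixes i :: nat
  assumes "i \<in> {2 ^ k..<2 ^ Suc k}" "i \<in> {2 ^ l..<2 ^ Suc l}" shows "k = l"
proof -
  have "(2::nat) ^ k < 2 ^ Suc l" "(2::nat) ^ l < 2 ^ Suc k" using assms by (auto intro: le_less_trans)
  then have "k < Suc l" "l < Suc k" by (metis one_less_numeral_iff power_less_imp_less_exp semiring_norm(76))+
  then show ?thesis by simp
qed

lemma level_index_permutes: "level_index L permutes {1..<2 ^ L}"
proof -
  have range: "level_index L p \<in> {1..<2 ^ L}" if p: "p \<in> {1..<2 ^ L}" for p
  proof -
    have "(2::nat) ^ Suc (L - 1 - multiplicity 2 p) \<le> 2 ^ L"
      using level_index_range(1)[OF p] by (intro power_increasing) auto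
    moreover have "(1::nat) \<le> 2 ^ (L - 1 - multiplicity 2 p)" by simp
    ultimately show ?thesis using level_index_range(2)[OF p] unfolding atLeastLessThan_iff by linarith
  qed
  have inj: "inj_on (level_index L) {1..<2 ^ L}"
  proof (rule inj_onI)
    fix p q assume p: "p \<in> {1..<2 ^ L}" and q: "q \<in> {1..<2 ^ L}" and eq: "level_index L p = level_index L q"
    have "L - 1 - multiplicity 2 p = L - 1 - multiplicity 2 q"
      using level_index_range(2)[OF p] level_index_range(2)[OF q] unfolding eq by (rule dyadic_level_unique)
    then have v: "multiplicity 2 p = multiplicity 2 q"
      using level_index_range(1)[OF p] level_index_range(1)[OF q] by simp
    let ?v = "multiplicity 2 q"
    have d: "p div 2 ^ Suc ?v = q div 2 ^ Suc ?v"
      using eq p q by (simp add: level_index_def v)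
    have odd: "r = 2 ^ multiplicity 2 r * (2 * (r div 2 ^ Suc (multiplicity 2 r)) + 1)" if "0 < r" for r :: nat
    proof -
      have "r \<noteq> 0" "\<not> is_unit (2::nat)" using that by simp_all
      then obtain w where w: "r = 2 ^ multiplicity 2 r * w" "\<not> 2 dvd w"
        by (rule multiplicity_decompose')
      have "r div 2 ^ Suc (multiplicity 2 r) = r div 2 ^ multiplicity 2 r div 2"
        using div_mult2_eq[of r "2 ^ multiplicity 2 r" 2] by (simp only: power_Suc2)
      also have "r div 2 ^ multiplicity 2 r = w" by (subst w(1)) simp
      finally have half: "r div 2 ^ Suc (multiplicity 2 r) = w div 2" .
      have "2 * (w div 2) + 1 = w" using w(2) by presburger
      then show ?thesis unfolding half using w(1) by simp
    qed
    show "p = q" using odd[of p] odd[of q] p q unfolding v d by simp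
  qed
  have "level_index L ` {1..<2 ^ L} = {1..<2 ^ L}"
    by (rule endo_inj_surj) (use range inj in auto)
  then have "bij_betw (level_index L) {1..<2 ^ L} {1..<2 ^ L}" using inj by (simp add: bij_betw_def)
  then show ?thesis by (rule bij_imp_permutes) (simp only: level_index_def if_False)
qed

text \<open>
  The coefficients are numbered in level order, and \<open>\<sigma>\<close> runs through them in ruler order. With \<open>h\<close> the largest
  coefficient, the two iterated limits are at least \<open>h \<surd>L / 9\<close> and at most \<open>h\<close>.
\<close>

lemma not_asymptotically_symmetric_Tz: "\<not> asymptotically_symmetric_on Tz tz_norm"
proof
  assume "asymptotically_symmetric_on Tz tz_norm"
  then obtain C :: real where C: "\<And>m \<sigma> x U. \<sigma> permutes {1..m} \<Longrightarrow>
        (\<forall>i\<in>{1..m}. bounded_seq_on Tz tz_norm (x i)) \<Longrightarrow> (\<forall>i\<in>{1..m}. ultrafilter (U i)) \<Longrightarrow>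
        iterated_norm_Lim tz_norm m id x U \<le> C * iterated_norm_Lim tz_norm m \<sigma> x U"
    unfolding asymptotically_symmetric_on_def by blast
  obtain W :: "nat filter" where W: "ultrafilter W" "W \<le> sequentially"
    using ultrafilter_below[of sequentially] by (metis sequentially_bot)
  obtain L :: nat where L0: "(9 * \<bar>C\<bar>)\<^sup>2 < L" using reals_Archimedean2 by blast
  have "0 < L" using L0 by (metis gr0I of_nat_0 not_less zero_le_power2)
  have CL: "9 * \<bar>C\<bar> < sqrt L" using L0 by (rule real_less_rsqrt)
  define m :: nat where "m = 2 ^ L - 1"
  have m: "{1..m} = {1..<2 ^ L}" unfolding m_def by auto
  define \<sigma> where "\<sigma> = level_index L"
  have \<sigma>: "\<sigma> permutes {1..m}" unfolding \<sigma>_def m by (rule level_index_permutes)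
  define a where "a i = ruler (inv \<sigma> i)" for i
  have a\<sigma>: "a (\<sigma> p) = ruler p" for p by (simp add: a_def permutes_inverses(2)[OF \<sigma>])
  define h :: real where "h = sqrt (2 ^ (L - 1))"
  have h: "0 < h" by (simp add: h_def)
  have ruler_h: "ruler p \<le> h" if "p \<in> {1..m}" for p
  proof -
    have "p \<in> {1..<2 ^ L}" using that unfolding m .
    then have "multiplicity 2 p \<le> L - 1" using level_index_range(1)[of p L] by simp
    then show ?thesis unfolding ruler_def h_def by (intro real_sqrt_le_mono power_increasing) auto
  qed
  have a_level: "a i * sqrt (2 ^ l) = h" if l: "l < L" and i: "i \<in> {2 ^ l..<2 ^ Suc l}" for l i
  proof -
    have "(2::nat) ^ Suc l \<le> 2 ^ L" using l by (intro power_increasing) auto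
    moreover have "(1::nat) \<le> 2 ^ l" by simp
    ultimately have "i \<in> {1..m}" using i unfolding m atLeastLessThan_iff by linarith
    then obtain p where p: "p \<in> {1..m}" "i = \<sigma> p" using permutes_image[OF \<sigma>] by blast
    have pL: "p \<in> {1..<2 ^ L}" using p(1) unfolding m .
    have "l = L - 1 - multiplicity 2 p"
      by (rule dyadic_level_unique[OF i]) (use level_index_range(2)[OF pL] in \<open>simp add: p(2) \<sigma>_def\<close>)
    then have "L - 1 = multiplicity 2 p + l" using level_index_range(1)[OF pL] by simp
    then show ?thesis unfolding p(2) a\<sigma> ruler_def h_def by (simp add: power_add real_sqrt_mult)
  qed
  define x where "x i n = a i *\<^sub>R basis n" for i n
  define F where "F \<nu> = tz_norm (\<Sum>i=1..m. x i (\<nu> i))" for \<nu>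
  have lim: "iterated_norm_Lim tz_norm m \<tau> x (\<lambda>_. W) = iterated_Lim (\<lambda>_. W) F (map \<tau> [1..<Suc m]) (\<lambda>_. 0)" for \<tau>
    unfolding iterated_norm_Lim_def F_def[abs_def] ..
  have TNF: "0 \<le> F \<nu>" for \<nu> unfolding F_def x_def by (intro tz_norm_nonneg basis_combination_Tz)
  have nth: "map \<tau> [1..<Suc m] ! k = \<tau> (Suc k)" if "k < m" for \<tau> :: "nat \<Rightarrow> nat" and k
    using that by (simp del: upt_Suc)
  have along: "\<nu> (\<tau> p) < \<nu> (\<tau> q)"
    if inc: "\<And>p q. p < q \<Longrightarrow> q < length (map \<tau> [1..<Suc m]) \<Longrightarrow> \<nu> (map \<tau> [1..<Suc m] ! p) < \<nu> (map \<tau> [1..<Suc m] ! q)"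
      and pq: "p \<in> {1..m}" "q \<in> {1..m}" "p < q" for \<nu> \<tau> :: "nat \<Rightarrow> nat" and p q
  proof -
    have "map \<tau> [1..<Suc m] ! (p - 1) = \<tau> p" "map \<tau> [1..<Suc m] ! (q - 1) = \<tau> q"
      using nth[of "p - 1" \<tau>] nth[of "q - 1" \<tau>] pq by (simp_all del: upt_Suc)
    moreover have "p - 1 < q - 1" "q - 1 < length (map \<tau> [1..<Suc m])" using pq by auto
    ultimately show ?thesis using inc[of "p - 1" "q - 1"] by simp
  qed
  have upper: "iterated_norm_Lim tz_norm m \<sigma> x (\<lambda>_. W) \<le> h \<and> 0 \<le> iterated_norm_Lim tz_norm m \<sigma> x (\<lambda>_. W)"
  proof -
    have "0 \<le> iterated_norm_Lim tz_norm m \<sigma> x (\<lambda>_. W) \<and> iterated_norm_Lim tz_norm m \<sigma> x (\<lambda>_. W) \<le> h"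
      unfolding lim
    proof (rule iterated_Lim_increasing[OF W])
      show "distinct (map \<sigma> [1..<Suc m])" using permutes_inj_on[OF \<sigma>] by (simp add: distinct_map del: upt_Suc)
      fix \<nu> :: "nat \<Rightarrow> nat" assume inc: "\<And>p q. p < q \<Longrightarrow> q < length (map \<sigma> [1..<Suc m]) \<Longrightarrow> \<nu> (map \<sigma> [1..<Suc m] ! p) < \<nu> (map \<sigma> [1..<Suc m] ! q)"
      have "(\<Sum>i=1..m. x i (\<nu> i)) = (\<Sum>p=1..m. x (\<sigma> p) (\<nu> (\<sigma> p)))"
        using sum.permute[OF \<sigma>, of "\<lambda>i. x i (\<nu> i)"] by (simp add: o_def)
      then have "F \<nu> = tz_norm (\<Sum>p=1..m. ruler p *\<^sub>R basis (\<nu> (\<sigma> p)))" by (simp add: F_def x_def a\<sigma>)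
      also have "\<dots> \<le> h" by (rule ruler_order_upper) (use along[where \<nu> = \<nu> and \<tau> = \<sigma>, OF inc] ruler_h h in auto)
      finally show "0 \<le> F \<nu> \<and> F \<nu> \<le> h" using TNF by simp
    qed
    then show ?thesis by simp
  qed
  have lower: "h * sqrt L / 9 \<le> iterated_norm_Lim tz_norm m id x (\<lambda>_. W)"
  proof -
    \<comment> \<open>A crude upper bound, needed only to know that the limits exist.\<close>
    have bound: "F \<nu> \<le> (\<Sum>i=1..m. \<bar>a i\<bar>)" for \<nu>
    proof -
      have "tz_norm (\<Sum>i\<in>I. x i (\<nu> i)) \<le> (\<Sum>i\<in>I. \<bar>a i\<bar>)" if "finite I" for I
        using that
      proof (induction I rule: finite_induct)
        case empty
        have "tz_norm 0 = 0" using Tz.norm_eq_zero_iff[OF subspace_0[OF subspace_Tz]] by simp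
        then show ?case by (simp only: sum.empty order_refl)
      next
        case (insert i I)
        have one: "tz_norm (x i (\<nu> i)) \<le> \<bar>a i\<bar>"
          unfolding x_def Tz.norm_scaleR[OF basis_Tz] using mult_left_mono[OF tz_norm_basis_le] by fastforce
        have triangle: "tz_norm (x i (\<nu> i) + (\<Sum>i\<in>I. x i (\<nu> i))) \<le> tz_norm (x i (\<nu> i)) + tz_norm (\<Sum>i\<in>I. x i (\<nu> i))"
          unfolding x_def by (intro Tz.norm_triangle basis_combination_Tz scale_Tz basis_Tz)
        show ?case
          unfolding sum.insert[OF insert.hyps] by (rule order_trans[OF triangle add_mono[OF one insert.IH]])
      qed
      then show ?thesis by (simp add: F_def)
    qed
    have "h * sqrt L / 9 \<le> iterated_norm_Lim tz_norm m id x (\<lambda>_. W) \<and> iterated_norm_Lim tz_norm m id x (\<lambda>_. W) \<le> (\<Sum>i=1..m. \<bar>a i\<bar>)"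
      unfolding lim
    proof (rule iterated_Lim_increasing[OF W])
      show "distinct (map id [1..<Suc m])" by simp
      fix \<nu> :: "nat \<Rightarrow> nat" assume inc: "\<And>p q. p < q \<Longrightarrow> q < length (map id [1..<Suc m]) \<Longrightarrow> \<nu> (map id [1..<Suc m] ! p) < \<nu> (map id [1..<Suc m] ! q)"
      have "h * sqrt L / 9 \<le> tz_norm (\<Sum>i\<in>{1..<2 ^ L}. a i *\<^sub>R basis (\<nu> i))"
      proof (rule level_order_lower[where h = h])
        show "\<nu> i < \<nu> j" if "i \<in> {1..<2 ^ L}" "j \<in> {1..<2 ^ L}" "i < j" for i j
          using along[where \<nu> = \<nu> and \<tau> = id, OF inc, of i j] that unfolding m by simp
      qed (use a_level h in auto)
      then show "h * sqrt L / 9 \<le> F \<nu> \<and> F \<nu> \<le> (\<Sum>i=1..m. \<bar>a i\<bar>)"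
        using bound unfolding F_def x_def m by simp
    qed
    then show ?thesis by simp
  qed
  have "bounded_seq_on Tz tz_norm (x i)" for i
    unfolding bounded_seq_on_def
  proof (intro conjI allI exI)
    show "x i n \<in> Tz" for n unfolding x_def by (intro scale_Tz basis_Tz)
    show "tz_norm (x i n) \<le> \<bar>a i\<bar> * 1" for n
      unfolding x_def Tz.norm_scaleR[OF basis_Tz] by (intro mult_left_mono tz_norm_basis_le) auto
  qed
  then have "iterated_norm_Lim tz_norm m id x (\<lambda>_. W) \<le> C * iterated_norm_Lim tz_norm m \<sigma> x (\<lambda>_. W)"
    using C[OF \<sigma>, of x "\<lambda>_. W"] W(1) by simp
  also have "\<dots> \<le> \<bar>C\<bar> * iterated_norm_Lim tz_norm m \<sigma> x (\<lambda>_. W)"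
    using upper by (intro mult_right_mono) auto
  also have "\<dots> \<le> \<bar>C\<bar> * h" using upper by (intro mult_left_mono) auto
  finally have "h * sqrt L / 9 \<le> \<bar>C\<bar> * h" using lower by linarith
  then have "h * sqrt L \<le> h * (9 * \<bar>C\<bar>)" by (simp add: mult_ac)
  then have "sqrt L \<le> 9 * \<bar>C\<bar>" using h by simp
  then show False using CL by simp
qed

theorem theorem0p4:
  "\<exists>(Y :: (nat \<Rightarrow> real) set) (N :: (nat \<Rightarrow> real) \<Rightarrow> real).
     banach_space_on Y N \<and>
     reflexive_space_on Y N \<and>
     \<not> asymptotically_symmetric_on Y N \<and>
     (\<exists>C::real. \<forall>m \<sigma> x U.
        \<sigma> permutes {1..m} \<longrightarrow>
        (\<forall>i\<in>{1..m}. normalized_seq_on Y N (x i) \<and> weakly_null_on Y N (x i)) \<longrightarrow>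
        (\<forall>i\<in>{1..m}. ultrafilter (U i)) \<longrightarrow>
        iterated_norm_Lim N m id x U \<le> C * iterated_norm_Lim N m \<sigma> x U)"
proof (intro exI conjI allI impI)
  show "banach_space_on Tz tz_norm" by (rule banach_Tz)
  show "reflexive_space_on Tz tz_norm" by (rule reflexive_Tz)
  show "\<not> asymptotically_symmetric_on Tz tz_norm" by (rule not_asymptotically_symmetric_Tz)
qed (rule normalized_weakly_null_symmetric)

end
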